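(* Let $I\subset R=\Bbbk[x_0,\ldots,x_n]$ be a nonzero proper monomial ideal with big-height $e$, let $\mathcal{Q}\subseteq\mathbb{R}^{n+1}$ be the symbolic polyhedron of $I$, and let $\mathfrak{m}=(x_0,\ldots,x_n)$. For all integers $r\ge 0$ and all integers $m\ge \max\bigl(er,\ \beta(I^r)/\alpha(\mathcal{Q})\bigr)$, $$I^{(m)}\subseteq \mathfrak{m}^{\lceil \alpha(\mathcal{Q})m\rceil-\beta(I^r)}\, I^r,$$ where $\alpha(\mathcal{Q})=\min\{a_0+a_1+\cdots+a_n \mid (a_0,\ldots,a_n)\in\mathcal{Q}\}$ and $\beta(I^r)$ is the maximum of the degrees of the minimal generators of $I^r$.
   Context: $\Bbbk$ is a field and $R=\Bbbk[x_0,\ldots,x_n]$. $\operatorname{Ass}(I)$ is the set of associated primes of $I$ (of $R/I$), and $\operatorname{maxAss}(I)$ is the subset of those maximal with respect to inclusion. The $m$-th symbolic power is $I^{(m)} = R\cap\bigcap_{P\in \operatorname{Ass}(I)} I^m R_P$ (with $I^0=R$, so $I^{(0)}=R$). The big-height of $I$ is the maximum of the heights of its associated primes. For $P\in\operatorname{maxAss}(I)$ put $Q_{\subseteq P}=R\cap I R_P$, a monomial ideal. For a monomial ideal $M$, $\mathcal{L}(M)=\{\mathbf{a}\in\mathbb{N}^{n+1}\mid \mathbf{x}^{\mathbf{a}}\in M\}$, where $\mathbb{N}$ is the set of non-negative integers and $\mathbf{x}^{\mathbf a}=x_0^{a_0}\cdots x_n^{a_n}$. The symbolic polyhedron of $I$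 is $\mathcal{Q}=\bigcap_{P\in\operatorname{maxAss}(I)}\operatorname{conv}(\mathcal{L}(Q_{\subseteq P}))\subseteq\mathbb{R}^{n+1}$, where $\operatorname{conv}$ denotes convex hull. *)

theory Defs
  imports
    "HOL-Analysis.Analysis"
    "HOL-Library.Poly_Mapping"
    "HOL-Library.Extended_Nat"
    "HOL-Computational_Algebra.Fraction_Field"
    "HOL-Algebra.QuotRing"
    "HOL-Algebra.Ideal_Product"
    "HOL-Algebra.Algebraic_Closure_Type"
begin

text \<open>
  The polynomial ring in the variables indexed by a nonempty finite type \<open>'n\<close>: a polynomial is a
  finitely supported function from exponents to coefficients. The order on \<open>'n\<close> only serves to
  obtain the library's integral domain instance, which the fraction field requires.
\<close>

type_synonym 'n exponent = "'n \<Rightarrow>\<^sub>0 nat"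
type_synonym ('n, 'k) mpoly = "'n exponent \<Rightarrow>\<^sub>0 'k"

abbreviation mpoly_ring :: "('n::{finite,linorder}, 'k::field) mpoly ring"
  where "mpoly_ring \<equiv> ring_of_type_algebra"

definition monomial :: "'n::{finite,linorder} exponent \<Rightarrow> ('n, 'k::field) mpoly"
  where "monomial a = Poly_Mapping.single a 1"

definition var :: "'n::{finite,linorder} \<Rightarrow> ('n, 'k::field) mpoly"
  where "var i = monomial (Poly_Mapping.single i 1)"

definition irrelevant_ideal :: "('n::{finite,linorder}, 'k::field) mpoly set"
  where "irrelevant_ideal = Idl\<^bsub>mpoly_ring\<^esub> (range var)"

text \<open>The exponent 0 gives \<open>one (ideals_set mpoly_ring)\<close>, the unit ideal.\<close>

definition ideal_power ::
    "('n::{finite,linorder}, 'k::field) mpoly set \<Rightarrow> nat \<Rightarrow> ('n, 'k) mpoly set"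
  where "ideal_power I m = I [^]\<^bsub>ideals_set mpoly_ring\<^esub> m"

definition monomial_ideal :: "('n::{finite,linorder}, 'k::field) mpoly set \<Rightarrow> bool"
  where "monomial_ideal I \<longleftrightarrow> (\<exists>A. I = Idl\<^bsub>mpoly_ring\<^esub> (monomial ` A))"

text \<open>The prime ideals that are the annihilator of an element \<open>x\<close> of the module \<open>R/I\<close>.\<close>

definition associated_primes ::
    "('n::{finite,linorder}, 'k::field) mpoly set \<Rightarrow> ('n, 'k) mpoly set set"
  where "associated_primes I =
    {P. primeideal P mpoly_ring \<and>
        (\<exists>x \<in> carrier (mpoly_ring Quot I).
           P = {g. (I +>\<^bsub>mpoly_ring\<^esub> g) \<otimes>\<^bsub>mpoly_ring Quot I\<^esub> x = \<zero>\<^bsub>mpoly_ring Quot I\<^esub>})}"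

definition max_associated_primes ::
    "('n::{finite,linorder}, 'k::field) mpoly set \<Rightarrow> ('n, 'k) mpoly set set"
  where "max_associated_primes I =
    {P \<in> associated_primes I. \<not> (\<exists>P' \<in> associated_primes I. P \<subset> P')}"

definition height :: "('n::{finite,linorder}, 'k::field) mpoly set \<Rightarrow> enat"
  where "height P = Sup {enat k | k. \<exists>C :: nat \<Rightarrow> ('n, 'k) mpoly set.
    (\<forall>i\<le>k. primeideal (C i) mpoly_ring) \<and> (\<forall>i<k. C i \<subset> C (Suc i)) \<and> C k = P}"

definition big_height :: "('n::{finite,linorder}, 'k::field) mpoly set \<Rightarrow> enat"
  where "big_height I = Sup (height ` associated_primes I)"

text \<open>
  Localizations are taken inside the fraction field, where the intersections with the polynomial
  ring make sense. For a prime ideal \<open>P\<close>, denominators outside \<open>P\<close> are nonzero.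
\<close>

definition to_fract :: "('n::{finite,linorder}, 'k::field) mpoly \<Rightarrow> ('n, 'k) mpoly fract"
  where "to_fract f = Fraction_Field.Fract f 1"

definition localization ::
    "('n::{finite,linorder}, 'k::field) mpoly set \<Rightarrow> ('n, 'k) mpoly fract ring"
  where "localization P = ring_of_type_algebra\<lparr>carrier := {Fraction_Field.Fract f s | f s. s \<notin> P}\<rparr>"

definition extended_ideal ::
    "('n::{finite,linorder}, 'k::field) mpoly set \<Rightarrow> ('n, 'k) mpoly set \<Rightarrow> ('n, 'k) mpoly fract set"
  where "extended_ideal J P = Idl\<^bsub>localization P\<^esub> (to_fract ` J)"

definition symbolic_power ::
    "('n::{finite,linorder}, 'k::field) mpoly set \<Rightarrow> nat \<Rightarrow> ('n, 'k) mpoly set"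
  where "symbolic_power I m =
    {f. to_fract f \<in> (\<Inter>P \<in> associated_primes I. extended_ideal (ideal_power I m) P)}"

definition Q_below ::
    "('n::{finite,linorder}, 'k::field) mpoly set \<Rightarrow> ('n, 'k) mpoly set \<Rightarrow> ('n, 'k) mpoly set"
  where "Q_below I P = {f. to_fract f \<in> extended_ideal I P}"

definition exponents :: "('n::{finite,linorder}, 'k::field) mpoly set \<Rightarrow> 'n exponent set"
  where "exponents M = {a. monomial a \<in> M}"

definition exponent_vector :: "'n::{finite,linorder} exponent \<Rightarrow> real ^ 'n::{finite,linorder}"
  where "exponent_vector a = (\<chi> i. real (Poly_Mapping.lookup a i))"

definition symbolic_polyhedron ::
    "('n::{finite,linorder}, 'k::field) mpoly set \<Rightarrow> (real ^ 'n::{finite,linorder}) set"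
  where "symbolic_polyhedron I =
    (\<Inter>P \<in> max_associated_primes I. convex hull (exponent_vector ` exponents (Q_below I P)))"

definition alpha :: "(real ^ 'n) set \<Rightarrow> real"
  where "alpha S = (LEAST d. d \<in> (\<lambda>a. \<Sum>i\<in>UNIV. a $ i) ` S)"

text \<open>The unique minimal set of monomials generating a monomial ideal, given by its exponents.\<close>

definition minimal_generators ::
    "('n::{finite,linorder}, 'k::field) mpoly set \<Rightarrow> 'n exponent set"
  where "minimal_generators M = (THE A.
    Idl\<^bsub>mpoly_ring\<^esub> (monomial ` A :: ('n, 'k) mpoly set) = M \<and>
    (\<forall>B. B \<subset> A \<longrightarrow> Idl\<^bsub>mpoly_ring\<^esub> (monomial ` B :: ('n, 'k) mpoly set) \<noteq> M))"

definition exponent_degree :: "'n::{finite,linorder} exponent \<Rightarrow> nat"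
  where "exponent_degree a = (\<Sum>i\<in>UNIV. Poly_Mapping.lookup a i)"

definition beta :: "('n::{finite,linorder}, 'k::field) mpoly set \<Rightarrow> nat"
  where "beta M = Max (exponent_degree ` minimal_generators M)"

end

theory Submission
  imports Defs
begin

text \<open>
  Everything is read off exponents: a monomial ideal is the span of an upward closed set of exponents,
  powers are sums of such sets, and for a prime \<open>P\<close> containing exactly the variables in \<open>S\<close> an
  exponent lies in \<open>I\<^sup>m R\<^sub>P\<close> iff raising some of its coordinates outside \<open>S\<close> moves it into
  the exponents of \<open>I\<^sup>m\<close>.

  Let \<open>u\<close> be the exponent of a monomial in \<open>I\<^bsup>(m)\<^esup>\<close> with \<open>m \<ge> e r\<close>. At an associated prime generated by
  at most \<open>e\<close> variables, \<open>u\<close> dominates a sum of \<open>m\<close> exponents of \<open>I\<close> on these variables, so by the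
  pigeonhole principle one of the summands is at most \<open>u / r\<close> there. Hence \<open>\<lfloor>u / r\<rfloor>\<close> lies in \<open>I\<close> locally
  at all these primes, thus in \<open>I\<close>, and \<open>u\<close> lies in \<open>I\<^sup>r\<close>. Since also \<open>u / m\<close> lies in the symbolic
  polyhedron, \<open>u\<close> has degree at least \<open>\<alpha> m\<close>, and splitting off a generator of \<open>I\<^sup>r\<close>, of degree at
  most \<open>\<beta>\<close>, leaves the claimed power of the irrelevant ideal.
\<close>

section \<open>Monomial ideals\<close>

lemma mpoly_ring_simps [simp]:
  "carrier (mpoly_ring :: ('n::{finite,linorder}, 'k::field) mpoly ring) = UNIV"
  "x \<otimes>\<^bsub>mpoly_ring\<^esub> y = x * y" "x \<oplus>\<^bsub>mpoly_ring\<^esub> y = x + y"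
  "\<zero>\<^bsub>mpoly_ring\<^esub> = (0 :: ('n, 'k) mpoly)" "\<one>\<^bsub>mpoly_ring\<^esub> = (1 :: ('n, 'k) mpoly)"
  by (simp_all add: ring_of_type_algebra_def)

lemma cring_mpoly_ring: "cring (mpoly_ring :: ('n::{finite,linorder}, 'k::field) mpoly ring)"
  by (rule cring_from_type_algebra)

lemma ring_mpoly_ring: "ring (mpoly_ring :: ('n::{finite,linorder}, 'k::field) mpoly ring)"
  by (rule ring_from_type_algebra)

text \<open>The carrier \<open>H\<close> is left open so that the same criterion serves the whole
  polynomial ring and the localization inside the fraction field. Negatives come from multiplying by
  \<open>- 1\<close>, whence the assumption \<open>- 1 \<in> H\<close>.\<close>

lemma ideal_type_algebraI:
  fixes I H :: "'a::comm_ring_1 set"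
  assumes R: "ring (ring_of_type_algebra\<lparr>carrier := H\<rparr>)"
    and "I \<subseteq> H" "0 \<in> I" "\<And>a b. a \<in> I \<Longrightarrow> b \<in> I \<Longrightarrow> a + b \<in> I"
    and mult: "\<And>a x. a \<in> I \<Longrightarrow> x \<in> H \<Longrightarrow> x * a \<in> I" and "- 1 \<in> H"
  shows "ideal I (ring_of_type_algebra\<lparr>carrier := H\<rparr>)"
proof (rule idealI[OF R])
  interpret ring "ring_of_type_algebra\<lparr>carrier := H\<rparr>" by (rule R)
  show "subgroup I (add_monoid (ring_of_type_algebra\<lparr>carrier := H\<rparr>))"
  proof (rule add.subgroupI)
    fix a assume a: "a \<in> I"
    have "- a \<in> I" using mult[OF a \<open>- 1 \<in> H\<close>] by simp
    moreover have "\<ominus>\<^bsub>ring_of_type_algebra\<lparr>carrier := H\<rparr>\<^esub> a = - a"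
      by (rule minus_equality) (use a \<open>- a \<in> I\<close> \<open>I \<subseteq> H\<close> in \<open>auto simp: ring_of_type_algebra_def\<close>)
    ultimately show "\<ominus>\<^bsub>ring_of_type_algebra\<lparr>carrier := H\<rparr>\<^esub> a \<in> I" by simp
  qed (use assms in \<open>auto simp: ring_of_type_algebra_def\<close>)
qed (use mult in \<open>auto simp: ring_of_type_algebra_def mult.commute\<close>)

lemma ideal_mpolyI:
  fixes I :: "('n::{finite,linorder}, 'k::field) mpoly set"
  assumes "0 \<in> I" "\<And>a b. a \<in> I \<Longrightarrow> b \<in> I \<Longrightarrow> a + b \<in> I" "\<And>a x. a \<in> I \<Longrightarrow> x * a \<in> I"
  shows "ideal I mpoly_ring"
proof -
  have eq: "mpoly_ring\<lparr>carrier := UNIV\<rparr> = (mpoly_ring :: ('n, 'k) mpoly ring)"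
    by (simp add: ring_of_type_algebra_def)
  show ?thesis
    using ideal_type_algebraI[of UNIV I] assms ring_mpoly_ring unfolding eq by simp
qed

lemma ideal_mpolyD:
  fixes I :: "('n::{finite,linorder}, 'k::field) mpoly set"
  assumes "ideal I mpoly_ring"
  shows "0 \<in> I" "a \<in> I \<Longrightarrow> b \<in> I \<Longrightarrow> a + b \<in> I" "a \<in> I \<Longrightarrow> x * a \<in> I"
    "finite A \<Longrightarrow> (\<And>i. i \<in> A \<Longrightarrow> g i \<in> I) \<Longrightarrow> (\<Sum>i\<in>A. g i) \<in> I"
proof -
  interpret ideal I mpoly_ring by fact
  show *: "0 \<in> I" "a \<in> I \<Longrightarrow> b \<in> I \<Longrightarrow> a + b \<in> I" for a b
    using additive_subgroup.zero_closed[OF additive_subgroup_axioms]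
      additive_subgroup.a_closed[OF additive_subgroup_axioms, of a b] by auto
  show "a \<in> I \<Longrightarrow> x * a \<in> I" using I_l_closed[of a x] by simp
  show "finite A \<Longrightarrow> (\<And>i. i \<in> A \<Longrightarrow> g i \<in> I) \<Longrightarrow> (\<Sum>i\<in>A. g i) \<in> I"
    by (induction A rule: finite_induct) (auto intro: *)
qed

lemma primeideal_mpolyI:
  fixes P :: "('n::{finite,linorder}, 'k::field) mpoly set"
  assumes "ideal P mpoly_ring" "1 \<notin> P" "\<And>a b. a * b \<in> P \<Longrightarrow> a \<in> P \<or> b \<in> P"
  shows "primeideal P mpoly_ring"
  by (rule primeidealI) (use assms cring_mpoly_ring in auto)

lemma primeideal_mpolyD:
  fixes P :: "('n::{finite,linorder}, 'k::field) mpoly set"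
  assumes "primeideal P mpoly_ring"
  shows "ideal P mpoly_ring" "a * b \<in> P \<Longrightarrow> a \<in> P \<or> b \<in> P" "1 \<notin> P"
proof -
  interpret primeideal P mpoly_ring by fact
  show I: "ideal P mpoly_ring" by (rule ideal_axioms)
  show "a * b \<in> P \<Longrightarrow> a \<in> P \<or> b \<in> P" using I_prime[of a b] by simp
  show "1 \<notin> P"
  proof
    assume "1 \<in> P"
    hence "x \<in> P" for x using ideal_mpolyD(3)[OF I, of 1 x] by simp
    thus False using I_notcarr by auto
  qed
qed

text \<open>Only the pair \<open>(a, b)\<close> can contribute to the convolution at
  \<open>a + b\<close>, so nothing can cancel there.\<close>

lemma lookup_mult_unique:
  fixes f g :: "'a::monoid_add \<Rightarrow>\<^sub>0 'b::semiring_0"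
  assumes "\<And>x y. x \<in> Poly_Mapping.keys f \<Longrightarrow> y \<in> Poly_Mapping.keys g \<Longrightarrow> x + y = a + b \<Longrightarrow> x = a \<and> y = b"
  shows "Poly_Mapping.lookup (f * g) (a + b) = Poly_Mapping.lookup f a * Poly_Mapping.lookup g b"
proof -
  have "Poly_Mapping.lookup (f * g) (a + b) =
      (\<Sum>(x, y). Poly_Mapping.lookup f x * Poly_Mapping.lookup g y when a + b = x + y)"
    by (simp add: times_poly_mapping.rep_eq prod_fun_unfold_prod)
  also have "\<dots> = Sum_any (\<lambda>p. (case p of (x, y) \<Rightarrow>
      Poly_Mapping.lookup f x * Poly_Mapping.lookup g y) when (a, b) = p)"
  proof (rule Sum_any.cong, clarify)
    fix x y
    show "(Poly_Mapping.lookup f x * Poly_Mapping.lookup g y when a + b = x + y) =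
       (Poly_Mapping.lookup f x * Poly_Mapping.lookup g y when (a, b) = (x, y))"
      using assms[of x y]
      by (cases "x \<in> Poly_Mapping.keys f \<and> y \<in> Poly_Mapping.keys g")
        (auto simp: when_def in_keys_iff)
  qed
  also have "\<dots> = Poly_Mapping.lookup f a * Poly_Mapping.lookup g b" by simp
  finally show ?thesis .
qed

lemma poly_mapping_sum_single:
  fixes f :: "'a \<Rightarrow>\<^sub>0 'b::comm_monoid_add"
  shows "(\<Sum>k\<in>Poly_Mapping.keys f. Poly_Mapping.single k (Poly_Mapping.lookup f k)) = f"
  by (rule poly_mapping_eqI)
    (auto simp: lookup_sum lookup_single when_def in_keys_iff)

section \<open>Upward closed sets of exponents and the monomial ideals they span\<close>

definition up_closed :: "'n exponent set \<Rightarrow> bool"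
  where "up_closed E \<longleftrightarrow> (\<forall>a\<in>E. \<forall>b. a + b \<in> E)"

definition monomial_span :: "'n::{finite,linorder} exponent set \<Rightarrow> ('n, 'k::field) mpoly set"
  where "monomial_span E = {f. Poly_Mapping.keys f \<subseteq> E}"

lemma up_closedD: "up_closed E \<Longrightarrow> a \<in> E \<Longrightarrow> a + b \<in> E"
  by (simp add: up_closed_def)

lemma up_closed_plus:
  assumes "up_closed E"
  shows "up_closed (F + E)"
proof -
  have "x + b \<in> F + E" if "x \<in> F + E" for x b
  proof -
    from that obtain f e where "x = f + e" "f \<in> F" "e \<in> E" by (rule set_plus_elim)
    thus ?thesis
      using set_plus_intro[of f F "e + b" E] up_closedD[OF assms] by (simp add: add.assoc)
  qed
  thus ?thesis by (simp add: up_closed_def)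
qed

lemma up_closed_UNIV [simp]: "up_closed UNIV"
  by (simp add: up_closed_def)

lemma monomial_in_span [simp]: "monomial a \<in> monomial_span E \<longleftrightarrow> a \<in> E"
  by (simp add: monomial_span_def monomial_def)

lemma monomial_mult: "monomial (a + b) = monomial a * monomial b"
  by (simp add: monomial_def mult_single)

lemma monomial_span_inject:
  "(monomial_span E :: ('n::{finite,linorder}, 'k::field) mpoly set) = monomial_span F \<longleftrightarrow> E = F"
proof
  assume eq: "(monomial_span E :: ('n, 'k) mpoly set) = monomial_span F"
  have "a \<in> E \<longleftrightarrow> a \<in> F" for a
    using arg_cong[OF eq, of "\<lambda>K. monomial a \<in> K"] by simp
  thus "E = F" by blast
qed simp

lemma ideal_monomial_span:
  assumes "up_closed E"
  shows "ideal (monomial_span E :: ('n::{finite,linorder}, 'k::field) mpoly set) mpoly_ring"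
proof (rule ideal_mpolyI)
  fix a x :: "('n, 'k) mpoly" assume "a \<in> monomial_span E"
  thus "x * a \<in> monomial_span E"
    using keys_mult[of x a] up_closedD[OF assms] unfolding monomial_span_def
    by (fastforce simp: add.commute)
qed (use keys_add in \<open>fastforce simp: monomial_span_def\<close>)+

text \<open>\<open>A + UNIV\<close> is the upward closure of \<open>A\<close>. A polynomial
  supported on it is the sum of its terms, and each term is a multiple of some generator.\<close>

lemma genideal_monomials:
  "Idl\<^bsub>mpoly_ring\<^esub> (monomial ` A) = (monomial_span (A + UNIV) :: ('n::{finite,linorder}, 'k::field) mpoly set)"
proof
  show "Idl\<^bsub>mpoly_ring\<^esub> (monomial ` A) \<subseteq> (monomial_span (A + UNIV) :: ('n, 'k) mpoly set)"
  proof (rule ring.genideal_minimal[OF ring_mpoly_ring ideal_monomial_span])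
    have "a \<in> A + UNIV" if "a \<in> A" for a using set_plus_intro[OF that, of 0] by simp
    thus "monomial ` A \<subseteq> (monomial_span (A + UNIV) :: ('n, 'k) mpoly set)" by auto
  qed (rule up_closed_plus, simp)
  show "(monomial_span (A + UNIV) :: ('n, 'k) mpoly set) \<subseteq> Idl\<^bsub>mpoly_ring\<^esub> (monomial ` A)"
  proof
    fix f :: "('n, 'k) mpoly" assume f: "f \<in> monomial_span (A + UNIV)"
    have I: "ideal (Idl\<^bsub>mpoly_ring\<^esub> (monomial ` A) :: ('n, 'k) mpoly set) mpoly_ring"
      by (rule ring.genideal_ideal[OF ring_mpoly_ring]) simp
    have "Poly_Mapping.single k (Poly_Mapping.lookup f k) \<in> Idl\<^bsub>mpoly_ring\<^esub> (monomial ` A)"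
      if "k \<in> Poly_Mapping.keys f" for k
    proof -
      from f that obtain a b where k: "k = a + b" "a \<in> A"
        unfolding monomial_span_def by (blast elim: set_plus_elim)
      have "(monomial a :: ('n, 'k) mpoly) \<in> Idl\<^bsub>mpoly_ring\<^esub> (monomial ` A)"
        using ring.genideal_self[OF ring_mpoly_ring, of "monomial ` A"] k(2) by auto
      from ideal_mpolyD(3)[OF I this, of "Poly_Mapping.single b (Poly_Mapping.lookup f k)"]
      show ?thesis by (simp add: monomial_def mult_single k(1) add.commute)
    qed
    hence "(\<Sum>k\<in>Poly_Mapping.keys f. Poly_Mapping.single k (Poly_Mapping.lookup f k))
        \<in> Idl\<^bsub>mpoly_ring\<^esub> (monomial ` A)"
      by (intro ideal_mpolyD(4)[OF I]) auto
    thus "f \<in> Idl\<^bsub>mpoly_ring\<^esub> (monomial ` A)" by (simp add: poly_mapping_sum_single)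
  qed
qed

text \<open>A term with exponent \<open>a + b\<close> factors into a term in \<open>a\<close>
  carrying the coefficient and the monomial in \<open>b\<close>; sums of such products exhaust the
  right-hand side.\<close>

lemma ideal_prod_monomial_span:
  "ideal_prod mpoly_ring (monomial_span E) (monomial_span F) =
    (monomial_span (E + F) :: ('n::{finite,linorder}, 'k::field) mpoly set)"
proof
  show "ideal_prod mpoly_ring (monomial_span E) (monomial_span F) \<subseteq>
      (monomial_span (E + F) :: ('n, 'k) mpoly set)"
  proof
    fix f :: "('n, 'k) mpoly" assume "f \<in> ideal_prod mpoly_ring (monomial_span E) (monomial_span F)"
    thus "f \<in> monomial_span (E + F)"
    proof (induction rule: ideal_prod.induct)
      case (prod i j)
      thus ?case using keys_mult[of i j] unfolding monomial_span_def
        by (fastforce intro: set_plus_intro)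
    next
      case (sum s1 s2)
      thus ?case using keys_add[of s1 s2] unfolding monomial_span_def by auto
    qed
  qed
  show "(monomial_span (E + F) :: ('n, 'k) mpoly set) \<subseteq>
      ideal_prod mpoly_ring (monomial_span E) (monomial_span F)"
  proof
    fix f :: "('n, 'k) mpoly" assume f: "f \<in> monomial_span (E + F)"
    let ?P = "ideal_prod mpoly_ring (monomial_span E) (monomial_span F) :: ('n, 'k) mpoly set"
    \<comment> \<open>The empty sum is obtained as the product of zero with zero.\<close>
    have zero: "0 \<in> ?P"
      using ideal_prod.prod[of 0 "monomial_span E" 0 "monomial_span F" mpoly_ring]
      by (simp add: monomial_span_def)
    have single: "Poly_Mapping.single k (Poly_Mapping.lookup f k) \<in> ?P" if k: "k \<in> Poly_Mapping.keys f" for k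
    proof -
      from f k obtain a b where ab: "k = a + b" "a \<in> E" "b \<in> F"
        unfolding monomial_span_def by (blast elim: set_plus_elim)
      have "Poly_Mapping.single a (Poly_Mapping.lookup f k) * monomial b \<in> ?P"
        using ideal_prod.prod[of "Poly_Mapping.single a (Poly_Mapping.lookup f k)" "monomial_span E"
            "monomial b" "monomial_span F" mpoly_ring] ab
        by (simp add: monomial_span_def monomial_def)
      thus ?thesis by (simp add: monomial_def mult_single ab(1))
    qed
    have "(\<Sum>k\<in>K. Poly_Mapping.single k (Poly_Mapping.lookup f k)) \<in> ?P"
      if "finite K" "K \<subseteq> Poly_Mapping.keys f" for K
      using that
    proof (induction K rule: finite_induct)
      case (insert x K)
      thus ?case
        using ideal_prod.sum[of _ mpoly_ring "monomial_span E" "monomial_span F"] single by auto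
    qed (simp add: zero)
    from this[of "Poly_Mapping.keys f"] show "f \<in> ?P" by (simp add: poly_mapping_sum_single)
  qed
qed

text \<open>The value at 0 is \<open>UNIV\<close>, the exponent set of the unit ideal, and not
  \<open>{0}\<close>; so the powers of an upward closed set are upward closed from the
  start.\<close>

primrec sumset_power :: "'n exponent set \<Rightarrow> nat \<Rightarrow> 'n exponent set" where
  "sumset_power E 0 = UNIV"
| "sumset_power E (Suc m) = sumset_power E m + E"

lemma ideal_power_monomial_span:
  "ideal_power (monomial_span E) m =
    (monomial_span (sumset_power E m) :: ('n::{finite,linorder}, 'k::field) mpoly set)"
  unfolding ideal_power_def
proof (induction m)
  case 0
  thus ?case by (simp add: ideals_set_def monomial_span_def)
next
  case (Suc m)
  thus ?case by (simp add: nat_pow_def ideals_set_def ideal_prod_monomial_span)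
qed

lemma up_closed_sumset_power: "up_closed E \<Longrightarrow> up_closed (sumset_power E m)"
  by (cases m) (simp_all add: up_closed_plus)

text \<open>The remainder \<open>b\<close> is what the starting value \<open>UNIV\<close>
  contributes.\<close>

lemma sumset_powerE:
  assumes "u \<in> sumset_power E m"
  obtains g b where "\<And>j. j < m \<Longrightarrow> g j \<in> E" "u = (\<Sum>j<m. g j) + b"
proof -
  have "\<exists>g b. (\<forall>j<m. g j \<in> E) \<and> u = (\<Sum>j<m. g j) + b"
    using assms
  proof (induction m arbitrary: u)
    case (Suc m)
    then obtain v a where va: "u = v + a" "v \<in> sumset_power E m" "a \<in> E"
      by (auto elim: set_plus_elim)
    with Suc.IH obtain g b where "\<forall>j<m. g j \<in> E" "v = (\<Sum>j<m. g j) + b" by blast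
    with va show ?case
      by (intro exI[of _ "g(m := a)"] exI[of _ b]) (auto simp: less_Suc_eq ac_simps)
  qed auto
  thus ?thesis using that by blast
qed

lemma sumset_powerI:
  assumes "up_closed E" "\<And>j. j < m \<Longrightarrow> g j \<in> E"
  shows "(\<Sum>j<m. g j) + b \<in> sumset_power E m"
proof -
  have "(\<Sum>j<m. g j) \<in> sumset_power E m"
    using assms(2) by (induction m) (auto intro: set_plus_intro)
  thus ?thesis using up_closedD up_closed_sumset_power[OF assms(1)] by blast
qed

section \<open>Localization at a prime\<close>

text \<open>For \<open>S\<close> the set of variables in a prime \<open>P\<close>, these are exactly
  the exponents of the monomials outside \<open>P\<close>, that is, of the monomials that become
  units in the localization.\<close>

definition exponents_off :: "'n set \<Rightarrow> 'n exponent set"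
  where "exponents_off S = {t. \<forall>i\<in>S. Poly_Mapping.lookup t i = 0}"

lemma exponents_off_0 [simp]: "0 \<in> exponents_off S"
  by (simp add: exponents_off_def)

lemma exponents_off_add [simp]:
  "a + b \<in> exponents_off S \<longleftrightarrow> a \<in> exponents_off S \<and> b \<in> exponents_off S"
  by (auto simp: exponents_off_def lookup_add)

text \<open>Among the monomials of \<open>f\<close> violating the claim take one of least degree in the variables \<open>S\<close>,
  ties broken by the monomial order, and multiply it by the least monomial of \<open>s\<close> free of \<open>S\<close>:
  the product cannot cancel in \<open>s * f\<close>.\<close>

lemma key_in_localization:
  fixes f s :: "('n::{finite,linorder}, 'k::field) mpoly"
  assumes E: "up_closed E" and sf: "s * f \<in> monomial_span E"
    and t: "t \<in> Poly_Mapping.keys s" "t \<in> exponents_off S"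
    and u: "u \<in> Poly_Mapping.keys f"
  shows "\<exists>t\<in>exponents_off S. u + t \<in> E"
proof (rule ccontr)
  assume contra: "\<not> ?thesis"
  define d where "d a = (\<Sum>i\<in>S. Poly_Mapping.lookup a i)" for a :: "'n exponent"
  have d_add: "d (a + b) = d a + d b" for a b by (simp add: d_def lookup_add sum.distrib)
  have d0: "d a = 0 \<longleftrightarrow> a \<in> exponents_off S" for a by (simp add: d_def exponents_off_def)
  define U where "U = {u \<in> Poly_Mapping.keys f. \<forall>t. d t = 0 \<longrightarrow> u + t \<notin> E}"
  have "u \<in> U" using u contra by (auto simp: U_def d0)
  have finU: "finite U" by (simp add: U_def)
  define m where "m = Min (d ` U)"
  have m: "m \<in> d ` U" "\<And>v. v \<in> U \<Longrightarrow> m \<le> d v"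
    using finU \<open>u \<in> U\<close> unfolding m_def by (auto intro: Min_in)
  define u0 where "u0 = Min {v \<in> U. d v = m}"
  have u0: "u0 \<in> {v \<in> U. d v = m}" "\<And>v. v \<in> U \<Longrightarrow> d v = m \<Longrightarrow> u0 \<le> v"
    unfolding u0_def by (rule Min_in, use m finU in auto)
  have u0_E: "u0 + t \<notin> E" if "d t = 0" for t using u0(1) that by (auto simp: U_def)
  define t0 where "t0 = Min {v \<in> Poly_Mapping.keys s. d v = 0}"
  have t0: "t0 \<in> {v \<in> Poly_Mapping.keys s. d v = 0}"
    "\<And>v. v \<in> Poly_Mapping.keys s \<Longrightarrow> d v = 0 \<Longrightarrow> t0 \<le> v"
    unfolding t0_def by (rule Min_in, use t d0 in auto)
  have "x = t0 \<and> y = u0"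
    if xy: "x \<in> Poly_Mapping.keys s" "y \<in> Poly_Mapping.keys f" "x + y = t0 + u0" for x y
  proof -
    \<comment> \<open>If \<open>y\<close> did not violate the claim, some \<open>y + t\<close> would
      lie in \<open>E\<close>; adding \<open>x\<close> turns it into \<open>u0 + (t0 + t)\<close>,
      although \<open>u0\<close> violates the claim.\<close>
    have "y \<in> U"
    proof (rule ccontr)
      assume "y \<notin> U"
      then obtain t where "d t = 0" "y + t \<in> E" using xy by (auto simp: U_def)
      hence "u0 + (t0 + t) \<in> E"
        using up_closedD[OF E, of "y + t" x] xy(3) by (simp add: ac_simps)
      moreover have "d (t0 + t) = 0" using t0 \<open>d t = 0\<close> by (simp add: d_add)
      ultimately show False using u0_E[of "t0 + t"] by simp
    qed
    \<comment> \<open>Since \<open>t0\<close> is free of \<open>S\<close>, the two factors share the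
      minimal degree \<open>m\<close>; as \<open>y\<close> already has at least that much,
      \<open>x\<close> has none.\<close>
    moreover have "d x + d y = m" using arg_cong[OF xy(3), of d] t0(1) u0(1) by (simp add: d_add)
    ultimately have "d x = 0" "d y = m" using m(2)[of y] by auto
    hence "t0 \<le> x" "u0 \<le> y" using t0(2) u0(2) xy \<open>y \<in> U\<close> by auto
    thus ?thesis using xy(3) add_less_le_mono[of t0 x u0 y] add_le_less_mono[of t0 x u0 y]
      by (auto simp: order.order_iff_strict)
  qed
  hence "Poly_Mapping.lookup (s * f) (t0 + u0) = Poly_Mapping.lookup s t0 * Poly_Mapping.lookup f u0"
    by (rule lookup_mult_unique)
  also have "\<dots> \<noteq> 0" using t0(1) u0(1) by (auto simp: U_def in_keys_iff)
  finally have "u0 + t0 \<in> E" using sf by (auto simp: monomial_span_def in_keys_iff add.commute)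
  thus False using u0_E[of t0] t0(1) by simp
qed

lemma monomial_0 [simp]: "monomial 0 = 1"
  by (simp add: monomial_def)

lemma keys_monomial [simp]: "Poly_Mapping.keys (monomial a :: ('n::{finite,linorder}, 'k::field) mpoly) = {a}"
  by (simp add: monomial_def)

lemma exponent_split:
  fixes t :: "'n exponent"
  assumes "Poly_Mapping.lookup t i \<noteq> 0"
  shows "\<exists>t'. t = t' + Poly_Mapping.single i 1"
  using assms
  by (intro exI[of _ "t - Poly_Mapping.single i 1"] poly_mapping_eqI)
    (auto simp: lookup_add lookup_minus lookup_single when_def)

text \<open>If every term of \<open>s\<close> involved a variable of \<open>P\<close>, each term and
  therefore \<open>s\<close> itself would lie in \<open>P\<close>.\<close>

lemma key_off_prime:
  fixes s :: "('n::{finite,linorder}, 'k::field) mpoly"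
  assumes P: "ideal P mpoly_ring" and "s \<notin> P"
  shows "\<exists>t\<in>Poly_Mapping.keys s. t \<in> exponents_off {i. var i \<in> P}"
proof (rule ccontr)
  assume contra: "\<not> ?thesis"
  have "Poly_Mapping.single t (Poly_Mapping.lookup s t) \<in> P" if "t \<in> Poly_Mapping.keys s" for t
  proof -
    from contra that obtain i where "var i \<in> P" "Poly_Mapping.lookup t i \<noteq> 0"
      by (auto simp: exponents_off_def)
    moreover from this obtain t' where t: "t = t' + Poly_Mapping.single i 1"
      using exponent_split[of t i] by blast
    ultimately show ?thesis
      using ideal_mpolyD(3)[OF P, of "var i" "Poly_Mapping.single t' (Poly_Mapping.lookup s t)"]
      by (simp add: var_def monomial_def mult_single)
  qed
  hence "(\<Sum>t\<in>Poly_Mapping.keys s. Poly_Mapping.single t (Poly_Mapping.lookup s t)) \<in> P"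
    by (intro ideal_mpolyD(4)[OF P]) auto
  thus False using \<open>s \<notin> P\<close> by (simp add: poly_mapping_sum_single)
qed

lemma exponent_degree_add [simp]: "exponent_degree (a + b) = exponent_degree a + exponent_degree b"
  by (simp add: exponent_degree_def lookup_add sum.distrib)

lemma exponent_degree_single [simp]:
  "exponent_degree (Poly_Mapping.single i k :: 'n::{finite,linorder} exponent) = k"
  by (simp add: exponent_degree_def lookup_single when_def)

lemma exponent_degree_eq_0 [simp]:
  "exponent_degree (a :: 'n::{finite,linorder} exponent) = 0 \<longleftrightarrow> a = 0"
  by (auto simp: exponent_degree_def intro: poly_mapping_eqI)

lemma exponent_induct [case_names zero add]:
  fixes t :: "'n::{finite,linorder} exponent"
  assumes "P 0" "\<And>t i. P t \<Longrightarrow> P (t + Poly_Mapping.single i 1)"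
  shows "P t"
proof (induction "exponent_degree t" arbitrary: t)
  case (Suc d)
  hence "exponent_degree t \<noteq> 0" by linarith
  hence "t \<noteq> 0" by simp
  then obtain i where "Poly_Mapping.lookup t i \<noteq> 0" using poly_mapping_eqI[of t 0] by auto
  then obtain t' where t: "t = t' + Poly_Mapping.single i 1" using exponent_split[of t i] by blast
  have "P t'" by (rule Suc(1)) (use Suc(2) t in simp)
  thus ?case using assms(2) t by simp
qed (use assms in auto)

lemma monomial_notin_prime:
  fixes P :: "('n::{finite,linorder}, 'k::field) mpoly set"
  assumes P: "primeideal P mpoly_ring" and "t \<in> exponents_off {i. var i \<in> P}"
  shows "monomial t \<notin> P"
  using assms(2)
proof (induction t rule: exponent_induct)
  case zero
  thus ?case using primeideal_mpolyD(3)[OF P] by simp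
next
  case (add t i)
  hence "(var i :: ('n, 'k) mpoly) \<notin> P"
    by (auto simp: exponents_off_def lookup_add lookup_single when_def)
  moreover from add have "(monomial t :: ('n, 'k) mpoly) \<notin> P" by simp
  ultimately show ?case
    using primeideal_mpolyD(2)[OF P] unfolding monomial_mult var_def by blast
qed

section \<open>Extension to the local ring and contraction back, on polynomials and on
  exponents\<close>

lemma ring_localization:
  fixes P :: "('n::{finite,linorder}, 'k::field) mpoly set"
  assumes P: "primeideal P mpoly_ring"
  shows "ring (localization P)"
proof -
  let ?K = "ring_of_type_algebra :: ('n, 'k) mpoly fract ring"
  interpret K: ring ?K by (rule ring_from_type_algebra)
  have nz: "s \<noteq> 0" if "s \<notin> P" for s
    using that ideal_mpolyD(1)[OF primeideal_mpolyD(1)[OF P]] by auto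
  have "subring {Fraction_Field.Fract f s | f s. s \<notin> P} ?K"
  proof (rule K.subringI)
    show "\<one>\<^bsub>?K\<^esub> \<in> {Fraction_Field.Fract f s | f s. s \<notin> P}"
      using primeideal_mpolyD(3)[OF P] One_fract_def by (auto simp: ring_of_type_algebra_def)
  next
    fix h assume "h \<in> {Fraction_Field.Fract f s | f s. s \<notin> P}"
    then obtain f s where h: "h = Fraction_Field.Fract f s" "s \<notin> P" by blast
    have "\<ominus>\<^bsub>?K\<^esub> h = - h"
      by (rule K.minus_equality) (simp_all add: ring_of_type_algebra_def)
    also have "- h = Fraction_Field.Fract (- f) s" by (simp add: h)
    finally show "\<ominus>\<^bsub>?K\<^esub> h \<in> {Fraction_Field.Fract f s | f s. s \<notin> P}" using h by blast
  next
    fix h1 h2 assume "h1 \<in> {Fraction_Field.Fract f s | f s. s \<notin> P}"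
      "h2 \<in> {Fraction_Field.Fract f s | f s. s \<notin> P}"
    then obtain f s g t where h: "h1 = Fraction_Field.Fract f s" "s \<notin> P"
      "h2 = Fraction_Field.Fract g t" "t \<notin> P" by blast
    have st: "s * t \<notin> P" using h primeideal_mpolyD(2)[OF P] by blast
    have "h1 * h2 = Fraction_Field.Fract (f * g) (s * t)" using h by simp
    thus "h1 \<otimes>\<^bsub>?K\<^esub> h2 \<in> {Fraction_Field.Fract f s | f s. s \<notin> P}"
      using st by (auto simp: ring_of_type_algebra_def)
    have "h1 + h2 = Fraction_Field.Fract (f * t + g * s) (s * t)" using h nz by simp
    thus "h1 \<oplus>\<^bsub>?K\<^esub> h2 \<in> {Fraction_Field.Fract f s | f s. s \<notin> P}"
      using st by (auto simp: ring_of_type_algebra_def)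
  qed (simp add: ring_of_type_algebra_def)
  thus ?thesis unfolding localization_def by (rule K.subring_is_ring)
qed

text \<open>The fractions with numerator in \<open>J\<close> and denominator outside
  \<open>P\<close> form an ideal of the local ring that contains \<open>J\<close>, so they contain
  the extension of \<open>J\<close>. Conversely, \<open>s * f\<close> is divided by the unit
  \<open>s\<close>.\<close>

lemma to_fract_in_extended_ideal:
  fixes f :: "('n::{finite,linorder}, 'k::field) mpoly"
  assumes P: "primeideal P mpoly_ring" and J: "ideal J mpoly_ring"
  shows "to_fract f \<in> extended_ideal J P \<longleftrightarrow> (\<exists>s. s \<notin> P \<and> s * f \<in> J)"
proof
  note R = ring_localization[OF P]
  have nz: "s \<noteq> 0" if "s \<notin> P" for s
    using that ideal_mpolyD(1)[OF primeideal_mpolyD(1)[OF P]] by auto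
  have 1: "1 \<notin> P" by (rule primeideal_mpolyD(3)[OF P])
  note PD = primeideal_mpolyD(2)[OF P]
  note JD = ideal_mpolyD[OF J]
  {
    assume f: "to_fract f \<in> extended_ideal J P"
    define D where "D = {Fraction_Field.Fract g s | g s. g \<in> J \<and> s \<notin> P}"
    have "ideal D (localization P)"
      unfolding localization_def
    proof (rule ideal_type_algebraI)
      show "ring (ring_of_type_algebra\<lparr>carrier := {Fraction_Field.Fract f s |f s. s \<notin> P}\<rparr>)"
        using R by (simp add: localization_def)
      show "0 \<in> D" using 1 JD(1) unfolding D_def Zero_fract_def by blast
    next
      fix a b assume "a \<in> D" "b \<in> D"
      then obtain f s g t where h: "a = Fraction_Field.Fract f s" "s \<notin> P" "f \<in> J"
        "b = Fraction_Field.Fract g t" "t \<notin> P" "g \<in> J" unfolding D_def by blast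
      have "a + b = Fraction_Field.Fract (t * f + s * g) (s * t)" using h nz by (simp add: mult.commute)
      moreover have "s * t \<notin> P" using h PD by blast
      moreover have "t * f + s * g \<in> J" using h JD by blast
      ultimately show "a + b \<in> D" unfolding D_def by blast
    next
      fix a x assume "a \<in> D" "x \<in> {Fraction_Field.Fract f s |f s. s \<notin> P}"
      then obtain f s g t where h: "a = Fraction_Field.Fract f s" "s \<notin> P" "f \<in> J"
        "x = Fraction_Field.Fract g t" "t \<notin> P" unfolding D_def by blast
      have "x * a = Fraction_Field.Fract (g * f) (t * s)" using h by simp
      moreover have "t * s \<notin> P" using h PD by blast
      moreover have "g * f \<in> J" using h JD by blast
      ultimately show "x * a \<in> D" unfolding D_def by blast
    next
      have "- 1 = Fraction_Field.Fract (- 1) (1 :: ('n, 'k) mpoly)"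
        by (metis minus_fract One_fract_def)
      thus "- 1 \<in> {Fraction_Field.Fract f s |f s. s \<notin> P}" using 1 by blast
    qed (auto simp: D_def)
    moreover have "to_fract ` J \<subseteq> D" using 1 unfolding D_def to_fract_def by blast
    ultimately have "to_fract f \<in> D"
      using f ring.genideal_minimal[OF R, of D "to_fract ` J"] unfolding extended_ideal_def by blast
    then obtain g s where g: "Fraction_Field.Fract f 1 = Fraction_Field.Fract g s" "g \<in> J" "s \<notin> P"
      unfolding D_def to_fract_def by blast
    hence "s * f = g" using nz by (simp add: eq_fract mult.commute)
    thus "\<exists>s. s \<notin> P \<and> s * f \<in> J" using g by blast
  }
  assume "\<exists>s. s \<notin> P \<and> s * f \<in> J"
  then obtain s where s: "s \<notin> P" "s * f \<in> J" by blast
  have sub: "to_fract ` J \<subseteq> carrier (localization P)"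
    using 1 by (auto simp: to_fract_def localization_def)
  have I: "ideal (extended_ideal J P) (localization P)"
    unfolding extended_ideal_def by (rule ring.genideal_ideal[OF R sub])
  have "to_fract (s * f) \<in> extended_ideal J P"
    using s(2) ring.genideal_self[OF R sub] unfolding extended_ideal_def by blast
  moreover have "Fraction_Field.Fract 1 s \<in> carrier (localization P)"
    using s by (auto simp: localization_def)
  ultimately have "Fraction_Field.Fract 1 s * to_fract (s * f) \<in> extended_ideal J P"
    using ideal.I_l_closed[OF I] by (fastforce simp: localization_def ring_of_type_algebra_def)
  moreover have "Fraction_Field.Fract 1 s * to_fract (s * f) = to_fract f"
    using nz[OF s(1)] by (simp add: to_fract_def eq_fract)
  ultimately show "to_fract f \<in> extended_ideal J P" by simp
qed

lemma monomial_span_localization: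
  fixes f :: "('n::{finite,linorder}, 'k::field) mpoly"
  assumes P: "primeideal P mpoly_ring" and E: "up_closed E"
    and f: "to_fract f \<in> extended_ideal (monomial_span E) P" and u: "u \<in> Poly_Mapping.keys f"
  shows "\<exists>t\<in>exponents_off {i. var i \<in> P}. u + t \<in> E"
proof -
  from f obtain s where "s \<notin> P" "s * f \<in> monomial_span E"
    using to_fract_in_extended_ideal[OF P ideal_monomial_span[OF E]] by blast
  moreover from this obtain t where "t \<in> Poly_Mapping.keys s" "t \<in> exponents_off {i. var i \<in> P}"
    using key_off_prime[OF primeideal_mpolyD(1)[OF P]] by blast
  ultimately show ?thesis using key_in_localization[OF E _ _ _ u] by blast
qed

text \<open>By \<open>key_in_localization\<close>, denominators may be taken to be monomials outside
  \<open>P\<close>. This makes the symbolic polyhedron computable from exponents alone.\<close>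

lemma exponents_Q_below:
  fixes P :: "('n::{finite,linorder}, 'k::field) mpoly set"
  assumes P: "primeideal P mpoly_ring" and E: "up_closed E"
  shows "exponents (Q_below (monomial_span E) P) = {a. \<exists>t\<in>exponents_off {i. var i \<in> P}. a + t \<in> E}"
proof (intro Set.set_eqI iffI)
  fix a assume "a \<in> exponents (Q_below (monomial_span E) P)"
  hence "to_fract (monomial a) \<in> extended_ideal (monomial_span E) P"
    by (simp add: exponents_def Q_below_def)
  from monomial_span_localization[OF P E this, of a]
  show "a \<in> {a. \<exists>t\<in>exponents_off {i. var i \<in> P}. a + t \<in> E}" by simp
next
  fix a assume "a \<in> {a. \<exists>t\<in>exponents_off {i. var i \<in> P}. a + t \<in> E}"
  then obtain t where t: "t \<in> exponents_off {i. var i \<in> P}" "a + t \<in> E" by blast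
  have "monomial (t + a) \<in> (monomial_span E :: ('n, 'k) mpoly set)"
    using t(2) by (simp add: add.commute)
  with monomial_notin_prime[OF P t(1)] have "to_fract (monomial a) \<in> extended_ideal (monomial_span E) P"
    unfolding to_fract_in_extended_ideal[OF P ideal_monomial_span[OF E]] monomial_mult by blast
  thus "a \<in> exponents (Q_below (monomial_span E) P)" by (simp add: exponents_def Q_below_def)
qed

section \<open>Associated primes generated by variables\<close>

lemma up_closed_not_off: "up_closed (- exponents_off S)"
  by (simp add: up_closed_def)

lemma keys_mult_monomial:
  fixes g :: "('n::{finite,linorder}, 'k::field) mpoly"
  shows "Poly_Mapping.keys (g * monomial w) = (\<lambda>u. u + w) ` Poly_Mapping.keys g"
proof
  show "Poly_Mapping.keys (g * monomial w) \<subseteq> (\<lambda>u. u + w) ` Poly_Mapping.keys g"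
    using keys_mult[of g "monomial w"] by auto
  have "Poly_Mapping.lookup (g * monomial w) (u + w) = Poly_Mapping.lookup g u" for u
    using lookup_mult_unique[of g "monomial w" u w] by (simp add: monomial_def)
  thus "(\<lambda>u. u + w) ` Poly_Mapping.keys g \<subseteq> Poly_Mapping.keys (g * monomial w)"
    by (auto simp: in_keys_iff)
qed

text \<open>This is the ideal generated by the variables in \<open>S\<close>. If \<open>b\<close>
  has a term free of \<open>S\<close>, then \<open>key_in_localization\<close>, applied to the
  complement of \<open>exponents_off S\<close>, shows that no term of \<open>a\<close> is free of
  \<open>S\<close>.\<close>

lemma primeideal_variables:
  "primeideal (monomial_span (- exponents_off S) :: ('n::{finite,linorder}, 'k::field) mpoly set) mpoly_ring"
proof (rule primeideal_mpolyI)
  show "ideal (monomial_span (- exponents_off S) :: ('n, 'k) mpoly set) mpoly_ring"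
    by (rule ideal_monomial_span[OF up_closed_not_off])
  show "(1 :: ('n, 'k) mpoly) \<notin> monomial_span (- exponents_off S)"
    by (simp add: monomial_span_def)
next
  fix a b :: "('n, 'k) mpoly" assume ab: "a * b \<in> monomial_span (- exponents_off S)"
  show "a \<in> monomial_span (- exponents_off S) \<or> b \<in> monomial_span (- exponents_off S)"
  proof (rule disjCI)
    assume "b \<notin> monomial_span (- exponents_off S)"
    then obtain t where t: "t \<in> Poly_Mapping.keys b" "t \<in> exponents_off S"
      by (auto simp: monomial_span_def)
    have "u \<notin> exponents_off S" if "u \<in> Poly_Mapping.keys a" for u
      using key_in_localization[OF up_closed_not_off _ t that] ab by (auto simp: mult.commute)
    thus "a \<in> monomial_span (- exponents_off S)" by (auto simp: monomial_span_def)
  qed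
qed

text \<open>The hypothesis on \<open>w\<close> says that the annihilator of the class of the
  monomial \<open>w\<close> is the prime generated by the variables in \<open>S\<close>; multiplying
  by a monomial merely shifts exponents, so terms can be tested one by one.\<close>

lemma associated_prime_variables:
  assumes E: "up_closed E" and w: "\<And>t. w + t \<in> E \<longleftrightarrow> t \<notin> exponents_off S"
  shows "monomial_span (- exponents_off S) \<in>
    associated_primes (monomial_span E :: ('n::{finite,linorder}, 'k::field) mpoly set)"
proof -
  let ?I = "monomial_span E :: ('n, 'k) mpoly set"
  have I: "ideal ?I mpoly_ring" by (rule ideal_monomial_span[OF E])
  interpret ideal ?I mpoly_ring by (rule I)
  let ?x = "?I +>\<^bsub>mpoly_ring\<^esub> monomial w"
  have x: "?x \<in> carrier (mpoly_ring Quot ?I)"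
    by (auto simp: FactRing_def A_RCOSETS_def')
  have "g \<in> monomial_span (- exponents_off S) \<longleftrightarrow>
      (?I +>\<^bsub>mpoly_ring\<^esub> g) \<otimes>\<^bsub>mpoly_ring Quot ?I\<^esub> ?x = \<zero>\<^bsub>mpoly_ring Quot ?I\<^esub>" for g
  proof -
    have "(?I +>\<^bsub>mpoly_ring\<^esub> g) \<otimes>\<^bsub>mpoly_ring Quot ?I\<^esub> ?x = ?I +>\<^bsub>mpoly_ring\<^esub> (g * monomial w)"
      using rcoset_mult_add[of g "monomial w"] by (simp add: FactRing_def)
    moreover have "?I +>\<^bsub>mpoly_ring\<^esub> h = ?I \<longleftrightarrow> h \<in> ?I" for h
      using a_rcos_self[of h] a_rcos_const[of h] by auto
    moreover have "g * monomial w \<in> ?I \<longleftrightarrow> g \<in> monomial_span (- exponents_off S)"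
      using w by (auto simp: monomial_span_def keys_mult_monomial add.commute)
    ultimately show ?thesis by (simp add: FactRing_def)
  qed
  thus ?thesis
    unfolding associated_primes_def using x primeideal_variables by blast
qed

lemma sum_off:
  "(\<And>i. i \<in> A \<Longrightarrow> f i \<in> exponents_off S) \<Longrightarrow> sum f A \<in> exponents_off S"
  by (induction A rule: infinite_finite_induct) auto

lemma exponent_le:
  fixes a b :: "'n exponent"
  assumes "\<And>i. Poly_Mapping.lookup a i \<le> Poly_Mapping.lookup b i"
  shows "b = a + (b - a)"
  by (rule poly_mapping_eqI) (simp add: lookup_add lookup_minus assms)

lemma up_closed_le:
  fixes a b :: "'n exponent"
  assumes "up_closed E" "a \<in> E" "\<And>i. Poly_Mapping.lookup a i \<le> Poly_Mapping.lookup b i"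
  shows "b \<in> E"
  using up_closedD[OF assms(1,2), of "b - a"] exponent_le[OF assms(3)] by simp

text \<open>Make the set of variables that never lead from \<open>w\<close> into \<open>E\<close> maximal. Multiplying \<open>w\<close> by the
  remaining variables alone then stays outside \<open>E\<close> only finitely often; start from the last place.\<close>

lemma exists_prime_colon:
  fixes E :: "'n::{finite,linorder} exponent set"
  assumes E: "up_closed E" and w: "w \<notin> E"
  obtains c S where "\<And>t. w + c + t \<in> E \<longleftrightarrow> t \<notin> exponents_off S"
proof -
  define TT where "TT = {T. \<forall>t\<in>exponents_off (- T). w + t \<notin> E}"
  have "exponents_off UNIV = {0 :: 'n exponent}"
    by (auto simp: exponents_off_def intro: poly_mapping_eqI)
  hence "{} \<in> TT" using w by (simp add: TT_def)
  then obtain T where T: "T \<in> TT" "\<And>T'. T' \<in> TT \<Longrightarrow> T \<subseteq> T' \<Longrightarrow> T' = T"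
    using finite_has_maximal[of TT] by auto
  define S where "S = - T"
  \<comment> \<open>By maximality of \<open>T\<close>, each further variable \<open>i\<close>
    together with those of \<open>T\<close> can move \<open>w\<close> into \<open>E\<close>.\<close>
  have "\<exists>t\<in>exponents_off (- insert i T). w + t \<in> E" if "i \<in> S" for i
    using T(2)[of "insert i T"] that by (auto simp: S_def TT_def)
  then obtain p where p: "\<And>i. i \<in> S \<Longrightarrow> p i \<in> exponents_off (- insert i T)"
    "\<And>i. i \<in> S \<Longrightarrow> w + p i \<in> E" by metis
  define W where "W = {s \<in> exponents_off T. \<forall>t\<in>exponents_off S. w + s + t \<notin> E}"
  have "0 \<in> W" using T(1) by (simp add: W_def S_def TT_def)
  \<comment> \<open>If \<open>s\<close> exceeded \<open>p i\<close> in the variable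
    \<open>i\<close>, the part of \<open>p i\<close> supported on \<open>T\<close> would already
    move \<open>w + s\<close> into \<open>E\<close>; hence \<open>p\<close> bounds every coordinate
    of \<open>s\<close>.\<close>
  have bound: "exponent_degree s < Suc (\<Sum>i\<in>UNIV. Poly_Mapping.lookup (p i) i)" if "s \<in> W" for s
  proof -
    have "Poly_Mapping.lookup s i \<le> Poly_Mapping.lookup (p i) i" for i
    proof (cases "i \<in> S")
      case True
      show ?thesis
      proof (rule ccontr)
        assume *: "\<not> ?thesis"
        define t where "t = p i - Poly_Mapping.single i (Poly_Mapping.lookup (p i) i)"
        have "t \<in> exponents_off S"
          using p(1)[OF True] True
          by (auto simp: t_def exponents_off_def lookup_minus lookup_single when_def S_def)
        moreover have "w + s + t \<in> E"
          by (rule up_closed_le[OF E p(2)[OF True]])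
            (use * in \<open>auto simp: t_def lookup_add lookup_minus lookup_single when_def\<close>)
        ultimately show False using that by (auto simp: W_def)
      qed
    next
      case False
      thus ?thesis using that by (simp add: W_def exponents_off_def S_def)
    qed
    thus ?thesis by (simp add: exponent_degree_def less_Suc_eq_le sum_mono)
  qed
  then obtain s where s: "s \<in> W" "\<And>s'. s' \<in> W \<Longrightarrow> exponent_degree s' \<le> exponent_degree s"
    using ex_has_greatest_nat[of "\<lambda>s. s \<in> W" 0 exponent_degree] \<open>0 \<in> W\<close> by blast
  have "\<exists>t\<in>exponents_off S. w + (s + Poly_Mapping.single i 1) + t \<in> E" if "i \<in> S" for i
  proof (rule ccontr)
    assume "\<not> ?thesis"
    moreover have "s + Poly_Mapping.single i 1 \<in> exponents_off T"
      using s(1) that by (auto simp: W_def S_def exponents_off_def lookup_add lookup_single when_def)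
    ultimately have "s + Poly_Mapping.single i 1 \<in> W" by (simp add: W_def)
    from s(2)[OF this] show False by simp
  qed
  then obtain q where q: "\<And>i. i \<in> S \<Longrightarrow> q i \<in> exponents_off S"
    "\<And>i. i \<in> S \<Longrightarrow> w + (s + Poly_Mapping.single i 1) + q i \<in> E" by metis
  \<comment> \<open>Adding all the \<open>q i\<close> at once makes any single variable of
    \<open>S\<close> sufficient to enter \<open>E\<close>; as \<open>sum q S\<close> is itself free
    of \<open>S\<close>, membership of \<open>s\<close> in \<open>W\<close> still keeps exponents
    free of \<open>S\<close> out of \<open>E\<close>.\<close>
  have "w + (s + sum q S) + t \<in> E \<longleftrightarrow> t \<notin> exponents_off S" for t
  proof
    assume "w + (s + sum q S) + t \<in> E"
    hence "w + s + (sum q S + t) \<in> E" by (simp add: add.assoc)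
    hence "sum q S + t \<notin> exponents_off S" using s(1) by (auto simp: W_def)
    thus "t \<notin> exponents_off S" using sum_off[of S q S] q(1) by simp
  next
    assume "t \<notin> exponents_off S"
    then obtain i where i: "i \<in> S" "Poly_Mapping.lookup t i \<noteq> 0" by (auto simp: exponents_off_def)
    then obtain t' where t': "t = t' + Poly_Mapping.single i 1" using exponent_split[of t i] by blast
    have "sum q S = q i + sum q (S - {i})" using i(1) by (simp add: sum.remove)
    hence "w + (s + sum q S) + t =
        (w + (s + Poly_Mapping.single i 1) + q i) + (sum q (S - {i}) + t')"
      unfolding t' by (simp add: ac_simps)
    thus "w + (s + sum q S) + t \<in> E" using up_closedD[OF E q(2)[OF i(1)]] by simp
  qed
  thus ?thesis using that by blast
qed

section \<open>Chains of primes, heights and maximal associated primes\<close>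

lemma le_heightI:
  fixes C :: "nat \<Rightarrow> ('n::{finite,linorder}, 'k::field) mpoly set"
  assumes "\<And>i. i \<le> k \<Longrightarrow> primeideal (C i) mpoly_ring" "\<And>i. i < k \<Longrightarrow> C i \<subset> C (Suc i)" "C k = P"
  shows "enat k \<le> height P"
  unfolding height_def by (rule Sup_upper) (use assms in blast)

lemma monomial_span_mono: "E \<subseteq> F \<Longrightarrow> monomial_span E \<subseteq> monomial_span F"
  by (auto simp: monomial_span_def)

lemma exponents_off_antimono: "S \<subseteq> T \<Longrightarrow> exponents_off T \<subseteq> exponents_off S"
  by (auto simp: exponents_off_def)

text \<open>Adjoining the variables of \<open>S\<close> one at a time, starting from the zero ideal,
  gives a strict chain of primes with \<open>card S\<close> steps.\<close>

lemma height_variables: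
  "enat (card S) \<le> height (monomial_span (- exponents_off S) :: ('n::{finite,linorder}, 'k::field) mpoly set)"
proof -
  obtain h where h: "bij_betw h {..<card S} S"
    using ex_bij_betw_nat_finite[of S] by (auto simp: atLeast0LessThan)
  define C :: "nat \<Rightarrow> ('n, 'k) mpoly set" where "C i = monomial_span (- exponents_off (h ` {..<i}))" for i
  show ?thesis
  proof (rule le_heightI[of _ C])
    fix i assume i: "i < card S"
    have "h ` {..<i} \<subseteq> h ` {..<Suc i}" by auto
    from exponents_off_antimono[OF this] have "C i \<subseteq> C (Suc i)"
      unfolding C_def by (intro monomial_span_mono) simp
    moreover have "h i \<notin> h ` {..<i}"
      using inj_on_image_mem_iff[of h "{..<card S}" i "{..<i}"] h i by (simp add: bij_betw_def)
    hence "monomial (Poly_Mapping.single (h i) 1) \<notin> C i"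
      by (auto simp: C_def exponents_off_def lookup_single when_def)
    moreover have "monomial (Poly_Mapping.single (h i) 1) \<in> C (Suc i)"
      by (auto simp: C_def exponents_off_def lookup_single when_def)
    ultimately show "C i \<subset> C (Suc i)" by blast
  next
    show "C (card S) = monomial_span (- exponents_off S)"
      using h by (simp add: C_def bij_betw_def)
  qed (simp add: C_def primeideal_variables)
qed

text \<open>Were every associated prime strictly contained in another one, there would be chains of
  them of any length; the top of a chain with \<open>Suc e\<close> steps would have height above
  \<open>e\<close>.\<close>

lemma max_associated_primes_nonempty:
  fixes I :: "('n::{finite,linorder}, 'k::field) mpoly set"
  assumes "associated_primes I \<noteq> {}" and e: "big_height I = enat e"
  shows "max_associated_primes I \<noteq> {}"
proof
  assume none: "max_associated_primes I = {}"
  obtain P where P: "P \<in> associated_primes I" using assms(1) by blast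
  have "\<exists>C. (\<forall>i\<le>k. C i \<in> associated_primes I) \<and> (\<forall>i<k. C i \<subset> C (Suc i))" for k
  proof (induction k)
    case 0
    show ?case using P by (intro exI[of _ "\<lambda>_. P"]) simp
  next
    case (Suc k)
    then obtain C where C: "\<forall>i\<le>k. C i \<in> associated_primes I" "\<forall>i<k. C i \<subset> C (Suc i)" by blast
    from C(1) have "C k \<in> associated_primes I" by simp
    moreover have "C k \<notin> max_associated_primes I" using none by simp
    ultimately obtain P' where "P' \<in> associated_primes I" "C k \<subset> P'"
      by (auto simp: max_associated_primes_def)
    with C show ?case
      by (intro exI[of _ "C(Suc k := P')"]) (auto simp: le_Suc_eq less_Suc_eq)
  qed
  from this[of "Suc e"] obtain C where C: "\<forall>i\<le>Suc e. C i \<in> associated_primes I" "\<forall>i<Suc e. C i \<subset> C (Suc i)"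
    by blast
  have "enat (Suc e) \<le> height (C (Suc e))"
    by (rule le_heightI[of _ C]) (use C in \<open>auto simp: associated_primes_def\<close>)
  also have "\<dots> \<le> big_height I"
    unfolding big_height_def using C(1) by (intro SUP_upper) auto
  finally show False using e by simp
qed

section \<open>Minimal generators and polyhedra\<close>

text \<open>Dickson's lemma, by induction on the set of coordinates compared. A finite set
  \<open>G\<close> for the old coordinates also handles all \<open>a\<close> whose new coordinate
  reaches the bound \<open>N\<close> of \<open>G\<close>; each of the finitely many smaller values
  \<open>k\<close> gets its own finite set \<open>H k\<close>.\<close>

lemma dickson:
  fixes L :: "'n::finite exponent set"
  shows "\<exists>G. finite G \<and> G \<subseteq> L \<and>
    (\<forall>a\<in>L. \<exists>g\<in>G. \<forall>i. Poly_Mapping.lookup g i \<le> Poly_Mapping.lookup a i)"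
proof -
  have "finite B \<Longrightarrow> \<exists>G. finite G \<and> G \<subseteq> L \<and>
      (\<forall>a\<in>L. \<exists>g\<in>G. \<forall>i\<in>B. Poly_Mapping.lookup g i \<le> Poly_Mapping.lookup a i)"
    for B :: "'n set" and L :: "'n exponent set"
  proof (induction B arbitrary: L rule: finite_induct)
    case empty
    show ?case
    proof (cases "L = {}")
      case False
      then obtain a where "a \<in> L" by blast
      thus ?thesis by (intro exI[of _ "{a}"]) auto
    qed auto
  next
    case (insert x B)
    obtain G where G: "finite G" "G \<subseteq> L"
      "\<forall>a\<in>L. \<exists>g\<in>G. \<forall>i\<in>B. Poly_Mapping.lookup g i \<le> Poly_Mapping.lookup a i"
      using insert.IH[of L] by auto
    define N where "N = Max (insert 0 ((\<lambda>g. Poly_Mapping.lookup g x) ` G))"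
    have N: "Poly_Mapping.lookup g x \<le> N" if "g \<in> G" for g
      unfolding N_def by (rule Max_ge) (use G that in auto)
    have "\<forall>k. \<exists>G. finite G \<and> G \<subseteq> {a \<in> L. Poly_Mapping.lookup a x = k} \<and>
      (\<forall>a\<in>{a \<in> L. Poly_Mapping.lookup a x = k}. \<exists>g\<in>G. \<forall>i\<in>B. Poly_Mapping.lookup g i \<le> Poly_Mapping.lookup a i)"
      by (intro allI insert.IH)
    then obtain H where H: "\<forall>k. finite (H k) \<and> H k \<subseteq> {a \<in> L. Poly_Mapping.lookup a x = k} \<and>
      (\<forall>a\<in>{a \<in> L. Poly_Mapping.lookup a x = k}. \<exists>g\<in>H k. \<forall>i\<in>B. Poly_Mapping.lookup g i \<le> Poly_Mapping.lookup a i)"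
      by (auto dest!: choice)
    show ?case
    proof (intro exI[of _ "G \<union> (\<Union>k<N. H k)"] conjI ballI)
      show "finite (G \<union> (\<Union>k<N. H k))" using G H by auto
      show "G \<union> (\<Union>k<N. H k) \<subseteq> L" using G H by auto
      fix a assume a: "a \<in> L"
      show "\<exists>g\<in>G \<union> (\<Union>k<N. H k). \<forall>i\<in>insert x B. Poly_Mapping.lookup g i \<le> Poly_Mapping.lookup a i"
      proof (cases "Poly_Mapping.lookup a x < N")
        case True
        from H have "\<forall>b\<in>{b \<in> L. Poly_Mapping.lookup b x = Poly_Mapping.lookup a x}.
            \<exists>g\<in>H (Poly_Mapping.lookup a x). \<forall>i\<in>B. Poly_Mapping.lookup g i \<le> Poly_Mapping.lookup b i"
          by blast
        with a obtain g where g: "g \<in> H (Poly_Mapping.lookup a x)"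
          "\<forall>i\<in>B. Poly_Mapping.lookup g i \<le> Poly_Mapping.lookup a i" by auto
        with H have "Poly_Mapping.lookup g x = Poly_Mapping.lookup a x" by auto
        with g True show ?thesis by (intro bexI[of _ g]) auto
      next
        case False
        from G(3) a obtain g where g: "g \<in> G"
          "\<forall>i\<in>B. Poly_Mapping.lookup g i \<le> Poly_Mapping.lookup a i" by auto
        with N[of g] False show ?thesis by (intro bexI[of _ g]) auto
      qed
    qed
  qed
  from this[of UNIV L] show ?thesis by simp
qed

text \<open>Minimality refers to divisibility, written additively, and not to the linear monomial
  order.\<close>

definition minimal_exponents :: "'n::{finite,linorder} exponent set \<Rightarrow> 'n exponent set"
  where "minimal_exponents E = {a \<in> E. \<forall>b c. b \<in> E \<longrightarrow> a = b + c \<longrightarrow> c = 0}"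

lemma minimal_exponents_generate:
  assumes "a \<in> E"
  shows "\<exists>b\<in>minimal_exponents E. \<exists>c. a = b + c"
  using assms
proof (induction "exponent_degree a" arbitrary: a rule: less_induct)
  case less
  show ?case
  proof (cases "a \<in> minimal_exponents E")
    case True
    thus ?thesis by (intro bexI[of _ a] exI[of _ 0]) auto
  next
    case False
    with less.prems obtain b c where bc: "b \<in> E" "a = b + c" "c \<noteq> 0"
      by (auto simp: minimal_exponents_def)
    have "exponent_degree c \<noteq> 0" using bc(3) by simp
    hence "exponent_degree b < exponent_degree a" unfolding bc(2) exponent_degree_add by linarith
    from less.hyps[OF this bc(1)] obtain b' c' where "b' \<in> minimal_exponents E" "b = b' + c'"
      by auto
    thus ?thesis using bc(2) by (intro bexI[of _ b'] exI[of _ "c' + c"]) (auto simp: add.assoc)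
  qed
qed

lemma minimal_exponents_plus_UNIV:
  assumes "up_closed E"
  shows "minimal_exponents E + UNIV = E"
proof (intro Set.set_eqI iffI)
  fix x assume "x \<in> minimal_exponents E + UNIV"
  thus "x \<in> E"
    by (auto elim!: set_plus_elim intro: up_closedD[OF assms] simp: minimal_exponents_def)
next
  fix x assume "x \<in> E"
  from minimal_exponents_generate[OF this] show "x \<in> minimal_exponents E + UNIV"
    by (auto intro: set_plus_intro)
qed

text \<open>A minimal exponent is a multiple of some generator and cannot be a proper one.\<close>

lemma minimal_exponents_subset:
  assumes "A + UNIV = E"
  shows "minimal_exponents E \<subseteq> A"
proof
  fix a assume a: "a \<in> minimal_exponents E"
  hence "a \<in> A + UNIV" using assms by (simp add: minimal_exponents_def)
  then obtain b c where bc: "a = b + c" "b \<in> A" by (rule set_plus_elim)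
  have "b \<in> E" using set_plus_intro[OF bc(2), of 0 UNIV] assms by simp
  with a bc(1) have "c = 0" by (simp add: minimal_exponents_def)
  with bc show "a \<in> A" by simp
qed

text \<open>Each minimal exponent dominates, hence equals, a member of the finite set from Dickson's
  lemma. Finiteness makes the \<open>Max\<close> in \<open>beta\<close> meaningful and the hull of
  the minimal exponents compact.\<close>

lemma finite_minimal_exponents: "finite (minimal_exponents E)"
proof -
  obtain G where G: "finite G" "G \<subseteq> E"
    "\<forall>a\<in>E. \<exists>g\<in>G. \<forall>i. Poly_Mapping.lookup g i \<le> Poly_Mapping.lookup a i"
    using dickson[of E] by auto
  have "minimal_exponents E \<subseteq> G"
  proof
    fix a assume a: "a \<in> minimal_exponents E"
    then obtain g where g: "g \<in> G" "\<forall>i. Poly_Mapping.lookup g i \<le> Poly_Mapping.lookup a i"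
      using G(3) by (auto simp: minimal_exponents_def)
    have eq: "a = g + (a - g)" by (rule exponent_le) (use g in auto)
    have "a - g = 0" using a g(1) G(2) eq unfolding minimal_exponents_def by auto
    with eq g(1) show "a \<in> G" by simp
  qed
  thus ?thesis using G(1) by (rule finite_subset)
qed

text \<open>Every generating set contains the minimal exponents, which generate by themselves; so an
  irredundant one equals them and the \<open>THE\<close> is well defined.\<close>

lemma minimal_generators_monomial_span:
  assumes E: "up_closed E"
  shows "minimal_generators (monomial_span E :: ('n::{finite,linorder}, 'k::field) mpoly set) =
    minimal_exponents E"
  unfolding minimal_generators_def genideal_monomials monomial_span_inject
proof (rule the_equality)
  have "B + UNIV \<noteq> E" if "B \<subset> minimal_exponents E" for B
    using minimal_exponents_subset[of B E] that by auto
  thus "minimal_exponents E + UNIV = E \<and> (\<forall>B. B \<subset> minimal_exponents E \<longrightarrow> B + UNIV \<noteq> E)"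
    using minimal_exponents_plus_UNIV[OF E] by simp
next
  fix A assume A: "A + UNIV = E \<and> (\<forall>B. B \<subset> A \<longrightarrow> B + UNIV \<noteq> E)"
  hence "minimal_exponents E \<subseteq> A" using minimal_exponents_subset by blast
  moreover from A minimal_exponents_plus_UNIV[OF E] have "\<not> minimal_exponents E \<subset> A" by auto
  ultimately show "A = minimal_exponents E" by auto
qed

lemma generator_of_degree_le_beta:
  assumes E: "up_closed E" and u: "u \<in> E"
  shows "\<exists>g\<in>E. \<exists>b. u = g + b \<and>
    exponent_degree g \<le> beta (monomial_span E :: ('n::{finite,linorder}, 'k::field) mpoly set)"
proof -
  from minimal_exponents_generate[OF u] obtain g b where g: "g \<in> minimal_exponents E" "u = g + b"
    by auto
  have "exponent_degree g \<le> beta (monomial_span E :: ('n, 'k) mpoly set)"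
    unfolding beta_def minimal_generators_monomial_span[OF E]
    by (rule Max_ge) (use g(1) finite_minimal_exponents in auto)
  with g show ?thesis by (intro bexI[of _ g] exI[of _ b]) (auto simp: minimal_exponents_def)
qed

section \<open>Convex hulls of exponent sets and attainment of the least degree\<close>

lemma exponent_vector_add: "exponent_vector (a + b) = exponent_vector a + exponent_vector b"
  by (simp add: exponent_vector_def vec_eq_iff lookup_add)

lemma exponent_vector_0 [simp]: "exponent_vector 0 = 0"
  by (simp add: exponent_vector_def vec_eq_iff)

lemma exponent_vector_sum: "exponent_vector (sum f A) = (\<Sum>i\<in>A. exponent_vector (f i))"
  by (induction A rule: infinite_finite_induct) (simp_all add: exponent_vector_add)

lemma exponent_vector_set_plus:
  "exponent_vector ` (A + B) = exponent_vector ` A + exponent_vector ` B"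
proof (intro Set.set_eqI iffI)
  fix x assume "x \<in> exponent_vector ` (A + B)"
  thus "x \<in> exponent_vector ` A + exponent_vector ` B"
    by (auto elim!: set_plus_elim simp: exponent_vector_add intro!: set_plus_intro)
next
  fix x assume "x \<in> exponent_vector ` A + exponent_vector ` B"
  then obtain a b where "x = exponent_vector a + exponent_vector b" "a \<in> A" "b \<in> B"
    by (auto elim!: set_plus_elim)
  thus "x \<in> exponent_vector ` (A + B)"
    by (intro image_eqI[of _ _ "a + b"]) (auto simp: exponent_vector_add intro: set_plus_intro)
qed

text \<open>Convex hulls commute with Minkowski sums, so this hull is closed under addition; it also
  contains 0 and all nonnegative multiples of the unit vectors, whose sums fill the orthant.\<close>

lemma convex_hull_exponent_vectors:
  "convex hull range exponent_vector = {x :: real ^ 'n::{finite,linorder}. \<forall>i. 0 \<le> x $ i}"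
proof
  have "convex {x :: (real, 'n) vec. \<forall>i. 0 \<le> x $ i}" by (auto simp: convex_def)
  thus "convex hull range exponent_vector \<subseteq> {x :: (real, 'n) vec. \<forall>i. 0 \<le> x $ i}"
    by (intro hull_minimal) (auto simp: exponent_vector_def)
next
  define K where "K = convex hull range (exponent_vector :: 'n exponent \<Rightarrow> _)"
  have "range (exponent_vector :: 'n exponent \<Rightarrow> _) + range exponent_vector = range exponent_vector"
  proof -
    have "UNIV + UNIV = (UNIV :: 'n exponent set)"
      using set_plus_intro[of 0 UNIV] by (metis UNIV_I UNIV_eq_I add_0)
    thus ?thesis by (metis exponent_vector_set_plus)
  qed
  hence KK: "K + K = K" unfolding K_def by (metis convex_hull_set_plus)
  have 0: "0 \<in> K" unfolding K_def by (rule hull_inc) (use exponent_vector_0 in \<open>metis rangeI\<close>)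
  have axis: "axis i c \<in> K" if "0 \<le> c" for i :: 'n and c :: real
  proof -
    \<comment> \<open>Any integer \<open>N\<close> above \<open>c\<close> will do:
      \<open>axis i c\<close> lies on the segment from 0 to the lattice point
      \<open>axis i N\<close>.\<close>
    obtain N :: nat where N: "c < real N" using reals_Archimedean2 by blast
    with that have pos: "real N > 0" by linarith
    have "axis i (real N) = exponent_vector (Poly_Mapping.single i N)"
      by (simp add: exponent_vector_def vec_eq_iff axis_def lookup_single when_def)
    hence "axis i (real N) \<in> K" unfolding K_def by (auto intro: hull_inc)
    moreover have "convex K" by (simp add: K_def)
    ultimately have "(1 - c / real N) *\<^sub>R 0 + (c / real N) *\<^sub>R axis i (real N) \<in> K"
      using 0 N pos that by (intro convexD_alt) auto
    moreover have "(c / real N) *\<^sub>R axis i (real N) = axis i c"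
      using pos by (simp add: vec_eq_iff axis_def)
    ultimately show ?thesis by simp
  qed
  show "{x :: (real, 'n) vec. \<forall>i. 0 \<le> x $ i} \<subseteq> convex hull range exponent_vector"
  proof
    fix x :: "(real, 'n) vec" assume "x \<in> {x. \<forall>i. 0 \<le> x $ i}"
    hence "(\<Sum>i\<in>A. axis i (x $ i)) \<in> K" for A
    proof (induction A rule: infinite_finite_induct)
      case (insert i A)
      thus ?case using set_plus_intro[OF axis[of "x $ i" i], of "\<Sum>i\<in>A. axis i (x $ i)" K] KK by simp
    qed (use 0 in auto)
    from this[of UNIV] have "(\<Sum>i\<in>UNIV. axis i (x $ i)) \<in> K" .
    moreover have "(\<Sum>i\<in>UNIV. axis i (x $ i)) = x"
      by (simp add: vec_eq_iff axis_def)
    ultimately show "x \<in> convex hull range exponent_vector" by (simp add: K_def)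
  qed
qed

text \<open>The hull is the Minkowski sum of a compact set, the hull of the finitely many minimal
  exponents, and the closed nonnegative orthant.\<close>

lemma closed_convex_hull_exponent_vectors:
  fixes L :: "'n::{finite,linorder} exponent set"
  assumes L: "up_closed L"
  shows "closed (convex hull (exponent_vector ` L))"
proof -
  have "closed ({x. 0 \<le> x $ i} :: ((real, 'n) vec) set)" for i
    by (intro closed_Collect_le continuous_intros)
  hence closed: "closed {x :: (real, 'n) vec. \<forall>i. 0 \<le> x $ i}"
    by (simp add: closed_Collect_all)
  have "convex hull (exponent_vector ` L) =
      convex hull (exponent_vector ` minimal_exponents L) + {x. \<forall>i. 0 \<le> x $ i}"
    using minimal_exponents_plus_UNIV[OF L]
    by (metis exponent_vector_set_plus convex_hull_set_plus convex_hull_exponent_vectors)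
  also have "\<dots> = (\<Union>x\<in>{x. \<forall>i. 0 \<le> x $ i}. \<Union>y\<in>convex hull (exponent_vector ` minimal_exponents L). {x + y})"
    by (subst add.commute) (auto simp: set_plus_def)
  also have "closed \<dots>"
    by (intro closed_compact_sums closed finite_imp_compact_convex_hull finite_imageI
        finite_minimal_exponents)
  finally show ?thesis .
qed

text \<open>The \<open>LEAST\<close> in \<open>alpha\<close> must be shown to be attained. The
  points of \<open>Q\<close> with coordinate sum at most that of \<open>x\<close> form a closed set,
  bounded because coordinates are nonnegative, so the sum has a minimum there, which is minimal on
  all of \<open>Q\<close>.\<close>

lemma alpha_le:
  fixes Q :: "(real ^ 'n) set" and x :: "real ^ 'n"
  assumes "closed Q" and nonneg: "\<And>y i. y \<in> Q \<Longrightarrow> 0 \<le> y $ i" and x: "x \<in> Q"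
  shows "alpha Q \<le> (\<Sum>i\<in>UNIV. x $ i)"
proof -
  define d where "d = (\<lambda>y :: real ^ 'n. \<Sum>i\<in>UNIV. y $ i)"
  have cont: "continuous_on A d" for A unfolding d_def by (intro continuous_intros)
  define K where "K = Q \<inter> {y. d y \<le> d x}"
  have "closed K"
    unfolding K_def by (intro closed_Int assms(1) closed_Collect_le continuous_intros cont)
  moreover have "norm y \<le> d x" if "y \<in> K" for y
  proof -
    have "norm y \<le> (\<Sum>i\<in>UNIV. \<bar>y $ i\<bar>)" by (rule norm_le_l1_cart)
    also have "\<dots> = d y"
      unfolding d_def using that nonneg by (intro sum.cong) (auto simp: K_def)
    finally show ?thesis using that by (simp add: K_def)
  qed
  hence "bounded K" by (auto simp: bounded_iff)
  ultimately have "compact K" by (simp add: compact_eq_bounded_closed)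
  moreover have "x \<in> K" using x by (simp add: K_def)
  ultimately obtain y where y: "y \<in> K" "\<And>z. z \<in> K \<Longrightarrow> d y \<le> d z"
    using continuous_attains_inf[of K d] cont by blast
  have "alpha Q = d y"
    unfolding alpha_def d_def[symmetric]
  proof (rule Least_equality)
    show "d y \<in> d ` Q" using y(1) by (simp add: K_def)
    fix c assume "c \<in> d ` Q"
    then obtain z where z: "z \<in> Q" "c = d z" by auto
    show "d y \<le> c"
    proof (cases "z \<in> K")
      case False
      thus ?thesis using y(1) z by (simp add: K_def)
    qed (use y z in simp)
  qed
  also have "\<dots> \<le> d x" using y(1) by (simp add: K_def)
  finally show ?thesis by (simp add: d_def)
qed

section \<open>Symbolic powers\<close>

definition restrict_exponent :: "'n::{finite,linorder} set \<Rightarrow> ('n \<Rightarrow> nat) \<Rightarrow> 'n exponent"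
  where "restrict_exponent S f = (\<Sum>i\<in>S. Poly_Mapping.single i (f i))"

lemma lookup_restrict_exponent [simp]:
  "Poly_Mapping.lookup (restrict_exponent S f) i = (if i \<in> S then f i else 0)"
  by (simp add: restrict_exponent_def lookup_sum lookup_single when_def)

lemma up_closed_localization:
  assumes "up_closed E"
  shows "up_closed {a. \<exists>t\<in>exponents_off S. a + t \<in> E}"
  unfolding up_closed_def
proof (intro ballI allI)
  fix a b assume "a \<in> {a. \<exists>t\<in>exponents_off S. a + t \<in> E}"
  then obtain t where "t \<in> exponents_off S" "a + t \<in> E" by auto
  moreover from up_closedD[OF assms this(2), of b] have "(a + b) + t \<in> E" by (simp add: ac_simps)
  ultimately show "a + b \<in> {a. \<exists>t\<in>exponents_off S. a + t \<in> E}" by auto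
qed

text \<open>Each summand is cut down to its coordinates in \<open>S\<close>. The parts cut off are
  free of \<open>S\<close> and witness that the summands lie in the local exponent set; on
  \<open>S\<close> the exponent \<open>t\<close> vanishes, so the sum stays below
  \<open>u\<close>.\<close>

lemma sumset_power_localization:
  fixes E :: "'n::{finite,linorder} exponent set"
  assumes E: "up_closed E" and t: "t \<in> exponents_off S" and ut: "u + t \<in> sumset_power E m"
  shows "u \<in> sumset_power {a. \<exists>t\<in>exponents_off S. a + t \<in> E} m"
proof -
  from ut obtain g b where gb: "\<And>j. j < m \<Longrightarrow> g j \<in> E" "u + t = (\<Sum>j<m. g j) + b"
    by (rule sumset_powerE) blast
  define h where "h j = restrict_exponent S (Poly_Mapping.lookup (g j))" for j
  have le: "Poly_Mapping.lookup (\<Sum>j<m. h j) i \<le> Poly_Mapping.lookup u i" for i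
  proof (cases "i \<in> S")
    case True
    hence "Poly_Mapping.lookup (\<Sum>j<m. h j) i = Poly_Mapping.lookup (\<Sum>j<m. g j) i"
      by (simp add: h_def lookup_sum)
    also have "\<dots> \<le> Poly_Mapping.lookup (u + t) i" by (simp add: gb(2) lookup_add)
    also have "\<dots> = Poly_Mapping.lookup u i" using t True by (simp add: lookup_add exponents_off_def)
    finally show ?thesis .
  qed (simp add: h_def lookup_sum)
  have "h j \<in> {a. \<exists>t\<in>exponents_off S. a + t \<in> E}" if "j < m" for j
  proof -
    have "h j + restrict_exponent (- S) (Poly_Mapping.lookup (g j)) = g j"
      by (rule poly_mapping_eqI) (simp add: h_def lookup_add)
    moreover have "restrict_exponent (- S) (Poly_Mapping.lookup (g j)) \<in> exponents_off S"
      by (simp add: exponents_off_def)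
    ultimately show ?thesis using gb(1)[OF that] by force
  qed
  hence "(\<Sum>j<m. h j) + (u - (\<Sum>j<m. h j)) \<in> sumset_power {a. \<exists>t\<in>exponents_off S. a + t \<in> E} m"
    by (rule sumset_powerI[OF up_closed_localization[OF E]])
  thus ?thesis using exponent_le[OF le] by simp
qed

lemma sumset_power_in_convex_hull:
  assumes L: "up_closed L" and u: "u \<in> sumset_power L m" and m: "m > 0"
  shows "(1 / real m) *\<^sub>R exponent_vector u \<in> convex hull (exponent_vector ` L)"
proof -
  from u obtain g b where gb: "\<And>j. j < m \<Longrightarrow> g j \<in> L" "u = (\<Sum>j<m. g j) + b"
    by (rule sumset_powerE) blast
  \<comment> \<open>The remainder is absorbed into the first summand, which makes \<open>u\<close> a
    sum of exactly \<open>m\<close> members of \<open>L\<close> and \<open>u / m\<close> their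
    average.\<close>
  define h where "h = g(0 := g 0 + b)"
  have h: "h j \<in> L" if "j < m" for j using gb(1)[OF that] up_closedD[OF L, of "g 0" b] by (auto simp: h_def)
  have "(\<Sum>j<m. h j) = h 0 + (\<Sum>j\<in>{..<m} - {0}. h j)" using m by (intro sum.remove) auto
  also have "(\<Sum>j\<in>{..<m} - {0}. h j) = (\<Sum>j\<in>{..<m} - {0}. g j)" by (rule sum.cong) (auto simp: h_def)
  also have "h 0 + \<dots> = (g 0 + (\<Sum>j\<in>{..<m} - {0}. g j)) + b" by (simp add: h_def ac_simps)
  also have "g 0 + (\<Sum>j\<in>{..<m} - {0}. g j) = (\<Sum>j<m. g j)"
    using m by (intro sum.remove[symmetric]) auto
  finally have "u = (\<Sum>j<m. h j)" using gb(2) by simp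
  hence "(1 / real m) *\<^sub>R exponent_vector u = (\<Sum>j<m. (1 / real m) *\<^sub>R exponent_vector (h j))"
    by (simp add: exponent_vector_sum scaleR_sum_right)
  also have "\<dots> \<in> convex hull (exponent_vector ` L)"
    by (rule convex_sum) (use m h in \<open>auto intro: hull_inc\<close>)
  finally show ?thesis .
qed

lemma symbolic_power_keys:
  fixes f :: "('n::{finite,linorder}, 'k::field) mpoly" and P :: "('n, 'k) mpoly set"
  assumes E: "up_closed E" and f: "f \<in> symbolic_power (monomial_span E) m"
    and u: "u \<in> Poly_Mapping.keys f" and P: "P \<in> associated_primes (monomial_span E)"
  shows "\<exists>t\<in>exponents_off {i. var i \<in> P}. u + t \<in> sumset_power E m"
proof (rule monomial_span_localization[OF _ up_closed_sumset_power[OF E] _ u])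
  show "primeideal P mpoly_ring" using P by (simp add: associated_primes_def)
  show "to_fract f \<in> extended_ideal (monomial_span (sumset_power E m)) P"
    using f P by (simp add: symbolic_power_def ideal_power_monomial_span)
qed

text \<open>The point \<open>u / m\<close> lies in the hull at every maximal associated prime, so
  its coordinate sum is at least \<open>alpha\<close>. Having some maximal prime places the
  polyhedron in the nonnegative orthant, as \<open>alpha_le\<close> requires.\<close>

lemma symbolic_power_degree:
  fixes f :: "('n::{finite,linorder}, 'k::field) mpoly"
  assumes E: "up_closed E" and f: "f \<in> symbolic_power (monomial_span E) m"
    and u: "u \<in> Poly_Mapping.keys f"
    and ne: "max_associated_primes (monomial_span E :: ('n, 'k) mpoly set) \<noteq> {}"
  shows "alpha (symbolic_polyhedron (monomial_span E :: ('n, 'k) mpoly set)) * real m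
    \<le> real (exponent_degree u)"
proof (cases "m = 0")
  case False
  let ?I = "monomial_span E :: ('n, 'k) mpoly set"
  let ?L = "\<lambda>P. {a. \<exists>t\<in>exponents_off {i. (var i :: ('n, 'k) mpoly) \<in> P}. a + t \<in> E}"
  have Q: "symbolic_polyhedron ?I =
      (\<Inter>P\<in>max_associated_primes ?I. convex hull (exponent_vector ` ?L P))"
    unfolding symbolic_polyhedron_def
    by (intro INF_cong refl arg_cong[of _ _ "\<lambda>A. convex hull (exponent_vector ` A)"] exponents_Q_below E)
      (simp add: max_associated_primes_def associated_primes_def)
  have closed: "closed (symbolic_polyhedron ?I)"
    unfolding Q by (intro closed_INT ballI closed_convex_hull_exponent_vectors up_closed_localization E)
  have nonneg: "0 \<le> y $ i" if y: "y \<in> symbolic_polyhedron ?I" for y :: "(real, 'n) vec" and i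
  proof -
    obtain P where "P \<in> max_associated_primes ?I" using ne by blast
    hence "y \<in> convex hull (exponent_vector ` ?L P)" using y unfolding Q by blast
    also have "\<dots> \<subseteq> convex hull range exponent_vector" by (intro hull_mono) auto
    finally show ?thesis by (simp add: convex_hull_exponent_vectors)
  qed
  have "(1 / real m) *\<^sub>R exponent_vector u \<in> symbolic_polyhedron ?I"
    unfolding Q
  proof
    fix P assume "P \<in> max_associated_primes ?I"
    hence "P \<in> associated_primes ?I" by (simp add: max_associated_primes_def)
    from symbolic_power_keys[OF E f u this] obtain t
      where "t \<in> exponents_off {i. (var i :: ('n, 'k) mpoly) \<in> P}" "u + t \<in> sumset_power E m" by blast
    from sumset_power_localization[OF E this]
    show "(1 / real m) *\<^sub>R exponent_vector u \<in> convex hull (exponent_vector ` ?L P)"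
      using False by (intro sumset_power_in_convex_hull up_closed_localization E) auto
  qed
  from alpha_le[OF closed nonneg this]
  have "alpha (symbolic_polyhedron ?I) \<le> (\<Sum>i\<in>UNIV. ((1 / real m) *\<^sub>R exponent_vector u) $ i)" .
  also have "\<dots> = real (exponent_degree u) / real m"
    by (simp add: exponent_vector_def exponent_degree_def sum_divide_distrib)
  finally show ?thesis using False by (simp add: field_simps)
qed simp

text \<open>Otherwise each of the \<open>m\<close> summands exceeds \<open>u / r\<close> in some variable of \<open>S\<close>; some variable is
  hit at least \<open>r\<close> times, and there the sum exceeds \<open>u\<close>.\<close>

lemma sumset_power_small_summand:
  fixes u :: "'n::{finite,linorder} exponent"
  assumes t: "t \<in> exponents_off S" and ut: "u + t \<in> sumset_power E m"
    and r: "r > 0" and S: "S \<noteq> {}" and m: "card S * r \<le> m"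
  shows "\<exists>g\<in>E. \<forall>i\<in>S. r * Poly_Mapping.lookup g i \<le> Poly_Mapping.lookup u i"
proof (rule ccontr)
  assume contra: "\<not> ?thesis"
  from ut obtain g b where gb: "\<And>j. j < m \<Longrightarrow> g j \<in> E" "u + t = (\<Sum>j<m. g j) + b"
    by (rule sumset_powerE) blast
  have "\<exists>i\<in>S. Poly_Mapping.lookup u i < r * Poly_Mapping.lookup (g j) i" if "j < m" for j
    using contra gb(1)[OF that] by (auto simp: not_le)
  then obtain c where c: "\<And>j. j < m \<Longrightarrow> c j \<in> S"
    "\<And>j. j < m \<Longrightarrow> Poly_Mapping.lookup u (c j) < r * Poly_Mapping.lookup (g j) (c j)" by metis
  \<comment> \<open>\<open>J i\<close> collects the summands charged to the variable
    \<open>i\<close>; these classes partition at least \<open>card S * r\<close> indices, so one of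
    them has at least \<open>r\<close> members.\<close>
  define J where "J i = {j. j < m \<and> c j = i}" for i
  have "\<exists>i\<in>S. r \<le> card (J i)"
  proof (rule ccontr)
    assume "\<not> ?thesis"
    hence lt: "(\<Sum>i\<in>S. card (J i)) < (\<Sum>i\<in>S. r)" using S by (intro sum_strict_mono) auto
    have "{..<m} = (\<Union>i\<in>S. J i)" using c(1) by (auto simp: J_def)
    hence "m = card (\<Union>i\<in>S. J i)" using card_lessThan[of m] by simp
    also have "\<dots> = (\<Sum>i\<in>S. card (J i))" by (rule card_UN_disjoint) (auto simp: J_def)
    finally show False using lt m by simp
  qed
  then obtain i where i: "i \<in> S" "r \<le> card (J i)" by blast
  \<comment> \<open>Scaled by \<open>r\<close>, each of the at least \<open>r\<close> summands in
    \<open>J i\<close> contributes at least one more than \<open>u\<close> has at \<open>i\<close>,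
    while \<open>t\<close> vanishes there.\<close>
  have "r * Poly_Mapping.lookup u i < r * (Poly_Mapping.lookup u i + 1)" using r by simp
  also have "\<dots> \<le> card (J i) * (Poly_Mapping.lookup u i + 1)" by (rule mult_right_mono) (use i in auto)
  also have "\<dots> = (\<Sum>j\<in>J i. Poly_Mapping.lookup u i + 1)" by simp
  also have "\<dots> \<le> (\<Sum>j\<in>J i. r * Poly_Mapping.lookup (g j) i)"
  proof (rule sum_mono)
    fix j assume "j \<in> J i"
    thus "Poly_Mapping.lookup u i + 1 \<le> r * Poly_Mapping.lookup (g j) i"
      using c(2)[of j] by (auto simp: J_def)
  qed
  also have "\<dots> \<le> (\<Sum>j<m. r * Poly_Mapping.lookup (g j) i)"
    by (rule sum_mono2) (auto simp: J_def)
  also have "\<dots> = r * Poly_Mapping.lookup (\<Sum>j<m. g j) i" by (simp add: lookup_sum sum_distrib_left)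
  also have "\<dots> \<le> r * Poly_Mapping.lookup (u + t) i" by (simp add: gb(2) lookup_add)
  also have "\<dots> = r * Poly_Mapping.lookup u i" using t i by (simp add: lookup_add exponents_off_def)
  finally show False by simp
qed

lemma variables_of_prime:
  "{i. (var i :: ('n::{finite,linorder}, 'k::field) mpoly) \<in> monomial_span (- exponents_off S)} = S"
  by (auto simp: var_def exponents_off_def lookup_single when_def)

text \<open>It is enough that \<open>v\<close>, the coordinatewise floor of \<open>u / r\<close>,
  lies in \<open>E\<close>, because \<open>r\<close> copies of it stay below \<open>u\<close>. If it
  did not, some multiple of \<open>v\<close> would have a prime annihilator generated by at most
  \<open>e\<close> variables, where the pigeonhole argument applies.\<close>

lemma symbolic_power_subset_power:
  fixes f :: "('n::{finite,linorder}, 'k::field) mpoly"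
  assumes E: "up_closed E" and ne: "E \<noteq> {}" and f: "f \<in> symbolic_power (monomial_span E) m"
    and u: "u \<in> Poly_Mapping.keys f"
    and e: "big_height (monomial_span E :: ('n, 'k) mpoly set) = enat e" and m: "e * r \<le> m"
  shows "u \<in> sumset_power E r"
proof (cases "r = 0")
  case False
  define v where "v = restrict_exponent UNIV (\<lambda>i. Poly_Mapping.lookup u i div r)"
  have "v \<in> E"
  proof (rule ccontr)
    assume "v \<notin> E"
    then obtain c S where cS: "\<And>t. v + c + t \<in> E \<longleftrightarrow> t \<notin> exponents_off S"
      by (rule exists_prime_colon[OF E]) blast
    define P :: "('n, 'k) mpoly set" where "P = monomial_span (- exponents_off S)"
    have P: "P \<in> associated_primes (monomial_span E)"
      unfolding P_def by (rule associated_prime_variables[OF E cS])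
    from symbolic_power_keys[OF E f u P] obtain t
      where t: "t \<in> exponents_off S" "u + t \<in> sumset_power E m"
      unfolding P_def variables_of_prime by blast
    have "enat (card S) \<le> height P" unfolding P_def by (rule height_variables)
    also have "\<dots> \<le> big_height (monomial_span E :: ('n, 'k) mpoly set)"
      unfolding big_height_def by (rule SUP_upper[OF P])
    finally have "card S \<le> e" using e by simp
    hence "card S * r \<le> m" using m by (meson le_trans mult_le_mono1)
    moreover obtain a where "a \<in> E" using ne by blast
    hence "v + c + a \<in> E" using up_closedD[OF E, of a "v + c"] by (simp add: add.commute)
    hence "S \<noteq> {}" unfolding cS by (auto simp: exponents_off_def)
    ultimately obtain g where g: "g \<in> E" "\<forall>i\<in>S. r * Poly_Mapping.lookup g i \<le> Poly_Mapping.lookup u i"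
      using sumset_power_small_summand[OF t] False by blast
    \<comment> \<open>On \<open>S\<close> the summand \<open>g\<close> is at most \<open>v\<close>,
      and off \<open>S\<close> it is added explicitly. The sum thus dominates \<open>g\<close>, yet
      it arises from \<open>v + c\<close> by an exponent free of \<open>S\<close>, which never leads
      into \<open>E\<close>.\<close>
    have "v + c + restrict_exponent (- S) (Poly_Mapping.lookup g) \<in> E"
    proof (rule up_closed_le[OF E g(1)])
      fix i
      have "Poly_Mapping.lookup g i \<le> Poly_Mapping.lookup u i div r" if "i \<in> S"
        using g(2) that False by (simp add: less_eq_div_iff_mult_less_eq mult.commute)
      thus "Poly_Mapping.lookup g i
          \<le> Poly_Mapping.lookup (v + c + restrict_exponent (- S) (Poly_Mapping.lookup g)) i"
        by (auto simp: lookup_add v_def)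
    qed
    thus False unfolding cS by (simp add: exponents_off_def)
  qed
  have "Poly_Mapping.lookup (\<Sum>j<r. v) i \<le> Poly_Mapping.lookup u i" for i
    by (simp add: lookup_sum v_def)
  from exponent_le[of "\<Sum>j<r. v" u, OF this]
  show ?thesis using sumset_powerI[OF E, of r "\<lambda>_. v" "u - (\<Sum>j<r. v)"] \<open>v \<in> E\<close> by simp
qed simp

section \<open>Powers of the irrelevant ideal and the containment\<close>

lemma irrelevant_ideal_eq:
  "irrelevant_ideal = (monomial_span (range (\<lambda>i. Poly_Mapping.single i 1) + UNIV) :: ('n::{finite,linorder}, 'k::field) mpoly set)"
proof -
  have "range var = (monomial ` range (\<lambda>i. Poly_Mapping.single i 1) :: ('n, 'k) mpoly set)"
    by (auto simp: var_def)
  thus ?thesis by (simp add: irrelevant_ideal_def genideal_monomials)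
qed

lemma degree_sumset_power_variables:
  fixes b :: "'n::{finite,linorder} exponent"
  assumes "d \<le> exponent_degree b"
  shows "b \<in> sumset_power (range (\<lambda>i. Poly_Mapping.single i 1) + UNIV) d"
  using assms
proof (induction d arbitrary: b)
  case (Suc d)
  hence "exponent_degree b \<noteq> 0" by linarith
  hence "b \<noteq> 0" by simp
  then obtain i where "Poly_Mapping.lookup b i \<noteq> 0" using poly_mapping_eqI[of b 0] by auto
  then obtain b' where b': "b = b' + Poly_Mapping.single i 1" using exponent_split[of b i] by blast
  with Suc.prems have "d \<le> exponent_degree b'" by simp
  from Suc.IH[OF this] have "b' \<in> sumset_power (range (\<lambda>i. Poly_Mapping.single i 1) + UNIV) d" .
  moreover have "Poly_Mapping.single i 1 \<in> range (\<lambda>i :: 'n. Poly_Mapping.single i (1 :: nat)) + UNIV"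
    using set_plus_intro[of "Poly_Mapping.single i 1" "range (\<lambda>i. Poly_Mapping.single i (1 :: nat))" 0 UNIV]
    by simp
  ultimately show ?case unfolding b' by (simp add: set_plus_intro)
qed simp

theorem theorem1p3:
  fixes I :: "('n::{finite,linorder}, 'k::field) mpoly set"
    and e r m :: nat
  assumes "monomial_ideal I"
    and "I \<noteq> {0}"
    and "I \<noteq> UNIV"
    and "big_height I = enat e"
    and "real m \<ge> max (real (e * r))
                    (real (beta (ideal_power I r)) / alpha (symbolic_polyhedron I))"
  shows "symbolic_power I m \<subseteq>
    ideal_prod mpoly_ring
      (ideal_power irrelevant_ideal
        (nat (\<lceil>alpha (symbolic_polyhedron I) * real m\<rceil> - int (beta (ideal_power I r)))))
      (ideal_power I r)"
proof -
  from assms(1) obtain A where "I = Idl\<^bsub>mpoly_ring\<^esub> (monomial ` A)"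
    unfolding monomial_ideal_def by blast
  then obtain E where E: "up_closed E" and I: "I = monomial_span E"
    using up_closed_plus[OF up_closed_UNIV, of A] by (simp add: genideal_monomials)
  have ne: "E \<noteq> {}" using assms(2) by (auto simp: I monomial_span_def)
  have "0 \<notin> E"
  proof
    assume "0 \<in> E"
    hence "E = UNIV" using up_closedD[OF E, of 0] by auto
    thus False using assms(3) by (simp add: I monomial_span_def)
  qed
  \<comment> \<open>Properness excludes 0 from \<open>E\<close>, so the construction started at 0
    produces an associated prime.\<close>
  then obtain c S where "\<And>t. 0 + c + t \<in> E \<longleftrightarrow> t \<notin> exponents_off S"
    by (rule exists_prime_colon[OF E]) blast
  from associated_prime_variables[OF E this] have "associated_primes I \<noteq> {}" unfolding I by blast
  hence max_ne: "max_associated_primes I \<noteq> {}"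
    using assms(4) by (rule max_associated_primes_nonempty)
  have m: "e * r \<le> m" using assms(5) by (simp flip: of_nat_mult)
  define \<beta> where "\<beta> = beta (ideal_power I r)"
  define d where "d = nat (\<lceil>alpha (symbolic_polyhedron I) * real m\<rceil> - int \<beta>)"
  show ?thesis
    unfolding \<beta>_def[symmetric] d_def[symmetric]
  proof
    fix f assume f: "f \<in> symbolic_power I m"
    let ?V = "range (\<lambda>i :: 'n. Poly_Mapping.single i (1 :: nat)) + UNIV"
    have "u \<in> sumset_power ?V d + sumset_power E r" if u: "u \<in> Poly_Mapping.keys f" for u
    proof -
      have "u \<in> sumset_power E r"
        using symbolic_power_subset_power[OF E ne _ u _ m] f assms(4) by (simp add: I)
      from generator_of_degree_le_beta[OF up_closed_sumset_power[OF E] this, where 'k = 'k]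
      obtain g b where g: "g \<in> sumset_power E r" "u = g + b" "exponent_degree g \<le> \<beta>"
        by (auto simp: \<beta>_def I ideal_power_monomial_span)
      have "alpha (symbolic_polyhedron I) * real m \<le> real (exponent_degree u)"
        using symbolic_power_degree[OF E _ u] f max_ne by (simp add: I)
      \<comment> \<open>The degree of \<open>u\<close> is an integer, so the bound survives rounding
        up; splitting off \<open>g\<close> then costs at most \<open>\<beta>\<close>.\<close>
      hence "\<lceil>alpha (symbolic_polyhedron I) * real m\<rceil> \<le> int (exponent_degree u)"
        by (simp add: ceiling_le_iff)
      hence "d \<le> exponent_degree b" using g(2,3) by (simp add: d_def)
      hence "b \<in> sumset_power ?V d" by (rule degree_sumset_power_variables)
      from set_plus_intro[OF this g(1)] show ?thesis by (simp add: g(2) add.commute)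
    qed
    hence "f \<in> monomial_span (sumset_power ?V d + sumset_power E r)"
      unfolding monomial_span_def by blast
    thus "f \<in> ideal_prod mpoly_ring (ideal_power irrelevant_ideal d) (ideal_power I r)"
      unfolding irrelevant_ideal_eq I ideal_power_monomial_span ideal_prod_monomial_span .
  qed
qed

end
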